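(* Let $n\ge 1$ and $L$ be integers with $2 \leq L \leq 2n+1$ such that $L$ is prime, and either $L$ divides $n$ or $L=2n+1$. Then in dimension $d = 2^n$ there exist $L$ mutually unbiased bases $\mathcal{B}_0,\ldots,\mathcal{B}_{L-1}$ of $\mathbb{C}^d$ for which there exists a unitary $U$ on $\mathbb{C}^d$ that cyclically permutes them, i.e. $$U \mathcal{B}_j = \mathcal{B}_{(j + 1) \bmod L}\qquad\text{for all } j\in\{0,\ldots,L-1\}.$$
   Context: Two orthonormal bases $\{|a\rangle\}$ and $\{|b\rangle\}$ of $\mathbb{C}^d$ are mutually unbiased if $|\langle a|b\rangle| = 1/\sqrt{d}$ for all elements $|a\rangle$ of the first and $|b\rangle$ of the second. A set of orthonormal bases is a set of mutually unbiased bases (MUBs) if every two distinct members are mutually unbiased. For a basis $\mathcal{B}$ and a unitary $U$, $U\mathcal{B}$ denotes the basis $\{U|b\rangle : |b\rangle\in\mathcal{B}\}$. *)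

theory Defs
  imports
    "HOL-Computational_Algebra.Primes"
    "Jordan_Normal_Form.Schur_Decomposition"
    "Jordan_Normal_Form.VS_Connect"
begin

(* The scalar product of Jordan_Normal_Form is conjugate-linear in its second
   argument, so the bracket (linear in the second argument) swaps the arguments. *)
definition braket :: "complex vec \<Rightarrow> complex vec \<Rightarrow> complex" where
  "braket a b = b \<bullet>c a"

definition orthonormal_basis :: "nat \<Rightarrow> complex vec set \<Rightarrow> bool" where
  "orthonormal_basis d B \<longleftrightarrow>
     vectorspace.basis class_ring (module_vec TYPE(complex) d) B \<and>
     (\<forall>u\<in>B. \<forall>v\<in>B. braket u v = (if u = v then 1 else 0))"

definition mutually_unbiased :: "nat \<Rightarrow> complex vec set \<Rightarrow> complex vec set \<Rightarrow> bool" where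
  "mutually_unbiased d A B \<longleftrightarrow> (\<forall>a\<in>A. \<forall>b\<in>B. cmod (braket a b) = 1 / sqrt (real d))"

definition mub_set :: "nat \<Rightarrow> complex vec set set \<Rightarrow> bool" where
  "mub_set d S \<longleftrightarrow>
     (\<forall>B\<in>S. orthonormal_basis d B) \<and>
     (\<forall>A\<in>S. \<forall>B\<in>S. A \<noteq> B \<longrightarrow> mutually_unbiased d A B)"

definition unitary_mat :: "nat \<Rightarrow> complex mat \<Rightarrow> bool" where
  "unitary_mat d U \<longleftrightarrow>
     U \<in> carrier_mat d d \<and> mat_adjoint U * U = 1\<^sub>m d \<and> U * mat_adjoint U = 1\<^sub>m d"

end

(*
  Let F be the field with 2^n elements, chi(x) = (-1)^Tr(x), and let the Weyl operators
  W(a,b) : f |-> (x |-> chi(bx) f(x+a)) act on the functions F -> C. Suppose that a unitary U with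
  U^L = 1 permutes the Weyl operators up to phases, and that for 0 < k < L the operators
  U^k W(0,b) U^-k have translation parts that run through all of F. The columns of U^k are common
  eigenvectors of these operators, so all entries of U^k have the same modulus. Hence the bases
  U^j (standard basis), 0 <= j < L, are mutually unbiased and cyclically permuted by U.

  If L divides n, U is a conjugate of the permutation matrix of the Frobenius power of order L.
  If L = 2n+1, then L divides 2^(2n) - 1 by Fermat, so SL_2(F) has an element of order L; U is the
  corresponding product of a Fourier transform and a quadratic phase, up to a power and a scalar.
*)

theory Submission
  imports "HOL-Algebra.Algebraic_Closure_Type" "HOL-Library.Z2" "HOL-Number_Theory.Residues" Defs
begin

(* With HOL-Algebra loaded, "prime" would otherwise denote the predicate on monoids. *)
hide_const (open) Divisibility.prime

section \<open>The field with \<open>2 ^ n\<close> elements and its quadratic characters\<close>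

text \<open>The obstacle is characteristic 2. A phase \<open>f\<close> that shears the Weyl labels
  by \<open>s\<close> has to satisfy \<open>f (x + y) = f x * f y * chi (s * x * y)\<close>. Away
  from characteristic 2 the character of \<open>s * x\<^sup>2 / 2\<close> would do; here
  \<open>y = x\<close> forces the square of \<open>f x\<close> to be
  \<open>chi (s * x\<^sup>2)\<close>, so for nonzero \<open>s\<close> the values i and -i must
  occur. They are supplied by a trace with values in Z/4, written through symmetric functions of
  conjugates so that everything stays inside \<open>F\<close>. A second difficulty is that Weyl
  labels determine a unitary only up to a Weyl operator and a phase. A conjugated permutation matrix
  has the exact order \<open>L\<close> for free; the Fourier-phase product does not, and squaring,
  harmless for odd \<open>L\<close>, removes the Weyl part. \<open>F\<close> is cut out of an
  algebraically closed field because the eigenvalues of the element of order \<open>L\<close> may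
  lie only in the quadratic extension of \<open>F\<close>. Primality of \<open>L\<close> ensures
  that no power \<open>k\<close> with \<open>0 < k < L\<close> falls into a smaller cycle.\<close>

locale char2_finite_field =
  fixes n :: nat and F :: "'a::alg_closed_field set"
  assumes n_pos: "n > 0" and char2: "CHAR('a) = 2" and F_eq: "F = {x. x ^ 2 ^ n = x}"
begin

lemma add_self [simp]: "x + x = (0::'a)"
proof -
  have "(2::'a) = 0"
    using of_nat_CHAR[where 'a='a] by (simp add: char2)
  then show ?thesis
    by (metis mult_2 mult_zero_left)
qed

lemma add_self_left [simp]: "x + (x + y) = (y::'a)"
  by (metis add.assoc add_self add_0)

lemma add_eq_0_iff_eq: "x + y = 0 \<longleftrightarrow> x = (y::'a)"
  by (metis add_self add_self_left add.right_neutral)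

lemma frobenius_add: "(x + y) ^ 2 ^ k = x ^ 2 ^ k + (y::'a) ^ 2 ^ k"
  using freshmans_dream'[of "2 ^ k" k x y] by (simp add: char2 two_is_prime_nat)

lemma square_add: "(x + y)\<^sup>2 = x\<^sup>2 + (y::'a)\<^sup>2"
  using frobenius_add[of x y 1] by simp

lemma square_sum: "(\<Sum>i\<in>A. f i)\<^sup>2 = (\<Sum>i\<in>A. (f i :: 'a)\<^sup>2)"
  by (induction A rule: infinite_finite_induct) (auto simp: square_add)

lemma frobenius_inj: "x ^ 2 ^ k = y ^ 2 ^ k \<longleftrightarrow> x = (y::'a)"
proof
  assume "x ^ 2 ^ k = y ^ 2 ^ k"
  then have "(x + y) ^ 2 ^ k = 0"
    by (simp add: frobenius_add)
  then show "x = y"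
    by (simp add: add_eq_0_iff_eq)
qed simp

lemma F_zero [simp]: "0 \<in> F" and F_one [simp]: "1 \<in> F"
  by (simp_all add: F_eq)

lemma F_add [simp]: "x \<in> F \<Longrightarrow> y \<in> F \<Longrightarrow> x + y \<in> F"
  by (simp add: F_eq frobenius_add)

lemma F_mult [simp]: "x \<in> F \<Longrightarrow> y \<in> F \<Longrightarrow> x * y \<in> F"
  by (simp add: F_eq power_mult_distrib)

lemma F_power [simp]: "x \<in> F \<Longrightarrow> x ^ k \<in> F"
  by (induction k) auto

lemma F_inverse [simp]: "x \<in> F \<Longrightarrow> inverse x \<in> F"
  by (simp add: F_eq power_inverse)

lemma F_divide [simp]: "x \<in> F \<Longrightarrow> y \<in> F \<Longrightarrow> x / y \<in> F"
  by (simp add: divide_inverse)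

lemma F_pow_card: "x \<in> F \<Longrightarrow> x ^ 2 ^ n = x"
  by (simp add: F_eq)

text \<open>The polynomial \<open>p\<close> has derivative -1, so a double root, which would also be
  a root of the derivative, is impossible. Over an algebraically closed field \<open>p\<close>
  therefore splits into as many distinct linear factors as its degree.\<close>

lemma finite_card_frobenius_fixed:
  assumes "k > 0"
  shows "finite {x::'a. x ^ 2 ^ k = x}" "card {x::'a. x ^ 2 ^ k = x} = 2 ^ k"
proof -
  define p :: "'a poly" where "p = Polynomial.monom 1 (2 ^ k) - Polynomial.monom 1 1"
  have k2: "(2::nat) ^ k > 1"
    using assms by (metis one_less_power one_less_numeral_iff semiring_norm(76))
  have deg: "Polynomial.degree p = 2 ^ k"
    unfolding p_def diff_conv_add_uminus using k2
    by (subst Polynomial.degree_add_eq_left) (auto simp: Polynomial.degree_monom_eq)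
  then have p0: "p \<noteq> 0"
    by auto
  have roots: "{x. poly p x = 0} = {x. x ^ 2 ^ k = x}"
    by (auto simp: p_def poly_monom)
  show "finite {x::'a. x ^ 2 ^ k = x}"
    using poly_roots_finite[OF p0] roots by simp
  have "of_nat (2 ^ k) = (0::'a)"
    using of_nat_CHAR[where 'a='a] assms by (simp add: char2)
  then have pd: "pderiv p = - 1"
    by (simp add: p_def pderiv_diff pderiv_monom)
  have order1: "order x p = 1" if x: "poly p x = 0" for x
  proof (rule ccontr)
    assume "order x p \<noteq> 1"
    moreover have "order x p \<noteq> 0"
      using x p0 by (simp add: order_root)
    ultimately have "2 \<le> order x p"
      by linarith
    then have "[:- x, 1:] ^ 2 dvd p"
      by (meson order_1 power_le_dvd)
    then obtain r where r: "p = [:- x, 1:] * ([:- x, 1:] * r)"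
      unfolding power2_eq_square mult.assoc by (rule dvdE) (simp only: mult.assoc)
    have "poly (pderiv p) x = 0"
      unfolding r pderiv_mult poly_add poly_mult by simp
    then show False
      by (simp add: pd)
  qed
  obtain A where A: "size A = Polynomial.degree p" "p = Polynomial.smult (Polynomial.lead_coeff p) (\<Prod>x\<in>#A. [:-x, 1:])"
    using alg_closed_imp_factorization[OF p0] by blast
  have "order x p = count A x" for x
  proof -
    have "order x p = order x (\<Prod>x\<in>#A. [:-x, 1:])"
      by (subst A(2), rule order_smult) (use p0 in auto)
    also have "\<dots> = count A x"
    proof (induction A)
      case (add y A)
      have "(\<Prod>x\<in>#A. [:-x, 1:]) \<noteq> 0"
        by (auto simp: prod_mset_zero_iff)
      then show ?case
        using add by (simp add: order_mult order_linear' del: mult_pCons_left)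
    qed (simp add: order_0I)
    finally show ?thesis .
  qed
  then have ordc: "count A x = (if poly p x = 0 then 1 else 0)" for x
    using order1 order_root p0 by (metis One_nat_def)
  have setA: "set_mset A = {x. poly p x = 0}"
    using ordc by (auto simp: set_mset_def split: if_splits)
  have "size A = (\<Sum>x\<in>set_mset A. count A x)"
    by (simp add: size_multiset_overloaded_eq)
  also have "\<dots> = (\<Sum>x\<in>set_mset A. 1)"
    by (intro sum.cong) (auto simp: ordc setA)
  finally show "card {x::'a. x ^ 2 ^ k = x} = 2 ^ k"
    using A(1) deg setA roots by simp
qed

lemma finite_F [simp]: "finite F" and card_F: "card F = 2 ^ n"
  using finite_card_frobenius_fixed[OF n_pos] by (simp_all add: F_eq)

text \<open>Needed to realize a prescribed shear \<open>s\<close>: the phase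
  \<open>quarter (t * x)\<close> shears by \<open>t\<^sup>2\<close>.\<close>

lemma F_square_root:
  assumes "s \<in> F"
  obtains t where "t \<in> F" "t\<^sup>2 = s"
proof
  show "s ^ 2 ^ (n - 1) \<in> F"
    using assms by simp
  have "(2::nat) ^ (n - 1) * 2 = 2 ^ n"
    using n_pos by (metis Suc_diff_1 power_Suc2)
  then show "(s ^ 2 ^ (n - 1))\<^sup>2 = s"
    using F_pow_card[OF assms] by (simp flip: power_mult)
qed

text \<open>
  The first and second elementary symmetric functions of the conjugates of \<open>x\<close>. They are the two
  binary digits of the trace of the Teichmueller representative of \<open>x\<close> in the Galois ring
  of characteristic 4.
\<close>

definition trc :: "nat \<Rightarrow> 'a \<Rightarrow> 'a" where
  "trc m x = (\<Sum>i<m. x ^ 2 ^ i)"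

definition esym2 :: "nat \<Rightarrow> 'a \<Rightarrow> 'a" where
  "esym2 m x = (\<Sum>j<m. trc j x * x ^ 2 ^ j)"

lemma trc_add: "trc m (x + y) = trc m x + trc m y"
  by (simp add: trc_def frobenius_add sum.distrib)

text \<open>Squaring is additive and moves each conjugate one place up; adding \<open>x\<close>
  refills the first place.\<close>

lemma trc_square_left: "(trc m x)\<^sup>2 + x = trc (Suc m) x"
proof -
  have "(trc m x)\<^sup>2 = (\<Sum>i<m. x ^ 2 ^ Suc i)"
    by (simp add: trc_def square_sum mult.commute flip: power_mult)
  then show ?thesis
    unfolding trc_def by (subst sum.lessThan_Suc_shift) (simp add: add.commute)
qed

lemma trc_square: "x \<in> F \<Longrightarrow> (trc n x)\<^sup>2 = trc n x"
  using trc_square_left[of n x] by (simp add: trc_def F_pow_card)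

lemma trc_of_square: "x \<in> F \<Longrightarrow> trc n (x\<^sup>2) = trc n x"
proof -
  assume x: "x \<in> F"
  have "trc n (x\<^sup>2) = (trc n x)\<^sup>2"
    by (simp add: trc_def square_sum mult.commute flip: power_mult)
  then show ?thesis
    using trc_square[OF x] by simp
qed

text \<open>Expanding over pairs of distinct conjugates, the mixed terms are the products of a
  conjugate of \<open>x\<close> and a conjugate of \<open>y\<close> at different places. They are
  all products, \<open>trc m x * trc m y\<close>, minus those at equal places,
  \<open>trc m (x * y)\<close>.\<close>

lemma esym2_add:
  "esym2 m (x + y) = esym2 m x + esym2 m y + trc m x * trc m y + trc m (x * y)"
proof (induction m)
  case (Suc m)
  have "trc (Suc m) z = trc m z + z ^ 2 ^ m" for z
    by (simp add: trc_def)
  moreover have "esym2 (Suc m) z = esym2 m z + trc m z * z ^ 2 ^ m" for z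
    by (simp add: esym2_def)
  moreover have "u + (v + u) = v" for u v :: 'a
    by (metis add.commute add_self_left)
  ultimately show ?case
    using Suc by (simp add: trc_add frobenius_add power_mult_distrib algebra_simps)
qed (simp add: esym2_def trc_def)

text \<open>Squaring permutes the conjugates of \<open>x\<close> cyclically, and a symmetric
  function does not notice. In the computation the shift leaves the two boundary terms
  \<open>g n\<close> and \<open>x * trc n x\<close>, which are equal and cancel.\<close>

lemma esym2_square:
  assumes "x \<in> F"
  shows "(esym2 n x)\<^sup>2 = esym2 n x"
proof -
  define g where "g j = trc j x * x ^ 2 ^ j" for j
  have "(esym2 n x)\<^sup>2 = (\<Sum>j<n. (trc j x)\<^sup>2 * x ^ 2 ^ Suc j)"
    by (simp add: esym2_def square_sum power_mult_distrib mult.commute flip: power_mult)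
  also have "\<dots> = (\<Sum>j<n. g (Suc j) + x * x ^ 2 ^ Suc j)"
  proof (rule sum.cong[OF refl])
    fix j
    have "(trc j x)\<^sup>2 = trc (Suc j) x + x"
      unfolding trc_square_left[symmetric] add.assoc by simp
    then show "(trc j x)\<^sup>2 * x ^ 2 ^ Suc j = g (Suc j) + x * x ^ 2 ^ Suc j"
      by (simp only: g_def distrib_right)
  qed
  also have "\<dots> = (\<Sum>j<n. g (Suc j)) + x * (\<Sum>j<n. x ^ 2 ^ Suc j)"
    by (simp only: sum.distrib sum_distrib_left)
  also have "(\<Sum>j<n. x ^ 2 ^ Suc j) = (trc n x)\<^sup>2"
    by (simp add: trc_def square_sum mult.commute flip: power_mult)
  also have "(trc n x)\<^sup>2 = trc n x"
    by (rule trc_square[OF assms])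
  also have "(\<Sum>j<n. g (Suc j)) = (\<Sum>j<n. g j) + g n"
    using sum.lessThan_Suc_shift[of g n] by (simp add: g_def trc_def)
  also have "g n = x * trc n x"
    by (simp add: g_def F_pow_card[OF assms])
  also have "(\<Sum>j<n. g j) = esym2 n x"
    by (simp add: g_def esym2_def)
  finally show ?thesis
    by (simp add: add.assoc)
qed

lemma idem_cases: "(z::'a)\<^sup>2 = z \<Longrightarrow> z = 0 \<or> z = 1"
  by (simp add: power2_eq_square)

lemma trc_cases: "x \<in> F \<Longrightarrow> trc n x = 0 \<or> trc n x = 1"
  by (rule idem_cases[OF trc_square])

lemma esym2_cases: "x \<in> F \<Longrightarrow> esym2 n x = 0 \<or> esym2 n x = 1"
  by (rule idem_cases[OF esym2_square])

text \<open>As a polynomial the trace is nonzero and its degree is at most half of the order of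
  \<open>F\<close>, so it cannot vanish on all of \<open>F\<close>.\<close>

lemma trc_nonzero: obtains z where "z \<in> F" "trc n z \<noteq> 0"
proof -
  define p :: "'a poly" where "p = (\<Sum>i<n. Polynomial.monom 1 (2 ^ i))"
  have poly_p: "poly p x = trc n x" for x
    by (simp add: p_def trc_def poly_sum poly_monom)
  have "Polynomial.coeff p (2 ^ (n - 1)) = (\<Sum>i<n. if i = n - 1 then 1 else 0)"
    by (simp add: p_def coeff_sum)
  also have "\<dots> = 1"
    using n_pos by simp
  finally have p0: "p \<noteq> 0"
    by auto
  have "Polynomial.degree p \<le> 2 ^ (n - 1)"
    unfolding p_def
  proof (rule degree_sum_le)
    fix i assume "i \<in> {..<n}"
    then have "(2::nat) ^ i \<le> 2 ^ (n - 1)"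
      by (intro power_increasing) auto
    then show "Polynomial.degree (Polynomial.monom (1::'a) (2 ^ i)) \<le> 2 ^ (n - 1)"
      by (simp add: Polynomial.degree_monom_eq)
  qed simp
  moreover have "(2::nat) ^ (n - 1) < 2 ^ n"
    using n_pos by simp
  ultimately have "card {x. poly p x = 0} < card F"
    using card_poly_roots_bound[OF p0] unfolding card_F by linarith
  then have "\<not> F \<subseteq> {x. poly p x = 0}"
    using card_mono poly_roots_finite[OF p0] leD by blast
  then show thesis
    using that poly_p by auto
qed

section \<open>The additive character and its fourth-root-valued quadratic refinement\<close>

definition chi :: "'a \<Rightarrow> complex" where
  "chi x = (if trc n x = 0 then 1 else - 1)"

text \<open>This is i to the power of the Z/4-valued trace with low digit \<open>trc n x\<close> and
  high digit \<open>esym2 n x\<close>. It replaces the missing character of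
  \<open>x\<^sup>2 / 2\<close>.\<close>

definition quarter :: "'a \<Rightarrow> complex" where
  "quarter x = (if trc n x = 0 then 1 else \<i>) * (if esym2 n x = 0 then 1 else - 1)"

lemma chi_0 [simp]: "chi 0 = 1" and quarter_0 [simp]: "quarter 0 = 1"
  by (simp_all add: chi_def quarter_def trc_def esym2_def)

lemma chi_cases: "chi x = 1 \<or> chi x = - 1"
  by (simp add: chi_def)

lemma chi_mult_self [simp]: "chi x * chi x = 1"
  by (simp add: chi_def)

lemma cnj_chi [simp]: "cnj (chi x) = chi x"
  by (simp add: chi_def)

lemma cmod_chi [simp]: "cmod (chi x) = 1" and cmod_quarter [simp]: "cmod (quarter x) = 1"
  by (simp_all add: chi_def quarter_def norm_mult)

lemma chi_add: "x \<in> F \<Longrightarrow> y \<in> F \<Longrightarrow> chi (x + y) = chi x * chi y"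
  using trc_cases[of x] trc_cases[of y] by (auto simp: chi_def trc_add)

text \<open>When both low digits are 1, the product of the two factors \<open>\<i>\<close> is a
  carry into the high digit. This sign cancels the term \<open>trc n x * trc n y\<close> of
  \<open>esym2_add\<close>, and the remaining term \<open>trc n (x * y)\<close> gives
  \<open>chi (x * y)\<close>.\<close>

lemma quarter_add:
  assumes "x \<in> F" "y \<in> F"
  shows "quarter (x + y) = quarter x * quarter y * chi (x * y)"
  using trc_cases[OF assms(1)] trc_cases[OF assms(2)] esym2_cases[OF assms(1)]
    esym2_cases[OF assms(2)] trc_cases[OF F_mult[OF assms]]
  by (elim disjE; simp add: quarter_def chi_def trc_add esym2_add)

lemma chi_of_square: "x \<in> F \<Longrightarrow> chi (x\<^sup>2) = chi x"
  by (simp add: chi_def trc_of_square)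

lemma chi_frobenius: "x \<in> F \<Longrightarrow> chi (x ^ 2 ^ k) = chi x"
proof (induction k)
  case (Suc k)
  then show ?case
    using chi_of_square[of "x ^ 2 ^ k"] by (simp add: mult.commute flip: power_mult)
qed simp

lemma chi_nondegenerate:
  assumes "b \<in> F" "b \<noteq> 0"
  obtains a where "a \<in> F" "chi (a * b) = - 1"
proof -
  obtain z where z: "z \<in> F" "trc n z \<noteq> 0"
    by (rule trc_nonzero)
  show thesis
    by (rule that[of "z / b"]) (use assms z in \<open>auto simp: chi_def\<close>)
qed

lemma bij_translate: "a \<in> F \<Longrightarrow> bij_betw (\<lambda>x. x + a) F F"
  by (rule bij_betw_byWitness[where f' = "\<lambda>x. x + a"]) (auto simp: add.assoc)

lemma sum_chi:
  assumes "b \<in> F"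
  shows "(\<Sum>x\<in>F. chi (x * b)) = (if b = 0 then 2 ^ n else 0)"
proof (cases "b = 0")
  case False
  obtain a where a: "a \<in> F" "chi (a * b) = - 1"
    by (rule chi_nondegenerate[OF assms False])
  have "(\<Sum>x\<in>F. chi (x * b)) = (\<Sum>x\<in>F. chi ((x + a) * b))"
    by (rule sum.reindex_bij_betw[OF bij_translate[OF a(1)], symmetric])
  also have "\<dots> = - (\<Sum>x\<in>F. chi (x * b))"
    using a assms by (simp add: distrib_right chi_add flip: sum_negf)
  finally have "(\<Sum>x\<in>F. chi (x * b)) = 0"
    by simp
  then show ?thesis
    using False by simp
qed (simp add: card_F)

end

section \<open>Bases from powers of a unitary\<close>

lemma mat_adjoint_index [simp]:
  assumes "i < dim_col A" "j < dim_row A"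
  shows "mat_adjoint A $$ (i, j) = conjugate (A $$ (j, i))"
  using assms by (simp add: mat_adjoint_def mat_of_rows_def)

lemma mat_adjoint_dim [simp]:
  "dim_row (mat_adjoint A) = dim_col A" "dim_col (mat_adjoint A) = dim_row A"
  by (simp_all add: mat_adjoint_def)

lemma mat_adjoint_mult:
  fixes A B :: "complex mat"
  assumes "A \<in> carrier_mat l m" "B \<in> carrier_mat m n"
  shows "mat_adjoint (A * B) = mat_adjoint B * mat_adjoint A"
  using assms by (intro eq_matI) (auto simp: scalar_prod_def mult.commute intro!: sum.cong)

lemma mat_adjoint_carrier [simp]: "A \<in> carrier_mat m n \<Longrightarrow> mat_adjoint A \<in> carrier_mat n m"
  by (metis carrier_matD carrier_matI mat_adjoint_dim)

lemma unitary_mat_carrier: "unitary_mat d U \<Longrightarrow> U \<in> carrier_mat d d"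
  by (simp add: unitary_mat_def)

lemma unitary_matI:
  assumes "U \<in> carrier_mat d d" "mat_adjoint U * U = 1\<^sub>m d"
  shows "unitary_mat d U"
  unfolding unitary_mat_def
proof (intro conjI)
  have "mat_adjoint U \<in> carrier_mat d d"
    using assms(1) by simp
  then show "U * mat_adjoint U = 1\<^sub>m d"
    using mat_mult_left_right_inverse assms by blast
qed (rule assms)+

lemma unitary_mat_mult:
  assumes "unitary_mat d U" "unitary_mat d V"
  shows "unitary_mat d (U * V)"
proof (rule unitary_matI)
  have U: "U \<in> carrier_mat d d" "mat_adjoint U \<in> carrier_mat d d" "mat_adjoint U * U = 1\<^sub>m d"
    and V: "V \<in> carrier_mat d d" "mat_adjoint V \<in> carrier_mat d d" "mat_adjoint V * V = 1\<^sub>m d"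
    using assms by (auto simp: unitary_mat_def)
  show "U * V \<in> carrier_mat d d"
    using U V by simp
  have "mat_adjoint (U * V) * (U * V) = mat_adjoint V * ((mat_adjoint U * U) * V)"
    unfolding mat_adjoint_mult[OF U(1) V(1)]
      assoc_mult_mat[OF V(2) U(2) mult_carrier_mat[OF U(1) V(1)]]
      assoc_mult_mat[OF U(2) U(1) V(1)] ..
  also have "\<dots> = 1\<^sub>m d"
    unfolding U(3) left_mult_one_mat[OF V(1)] by (rule V(3))
  finally show "mat_adjoint (U * V) * (U * V) = 1\<^sub>m d" .
qed

lemma unitary_mat_one: "unitary_mat d (1\<^sub>m d)"
  by (rule unitary_matI) (auto intro!: eq_matI)

lemma unitary_mat_pow: "unitary_mat d U \<Longrightarrow> unitary_mat d (U ^\<^sub>m k)"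
  by (induction k) (auto simp: unitary_mat_one unitary_mat_mult dest: unitary_mat_carrier)

lemma smult_smult_mat: "a \<cdot>\<^sub>m (b \<cdot>\<^sub>m A) = (a * b :: 'a::semigroup_mult) \<cdot>\<^sub>m A"
  by (intro eq_matI) (auto simp: mult.assoc)

lemma one_smult_mat [simp]: "(1 :: 'a::monoid_mult) \<cdot>\<^sub>m A = A"
  by (intro eq_matI) auto

lemma unitary_mat_smult:
  assumes "unitary_mat d U" "cmod r = 1"
  shows "unitary_mat d (r \<cdot>\<^sub>m U)"
proof (rule unitary_matI)
  have U: "U \<in> carrier_mat d d" "mat_adjoint U \<in> carrier_mat d d" "mat_adjoint U * U = 1\<^sub>m d"
    using assms by (auto simp: unitary_mat_def)
  show "r \<cdot>\<^sub>m U \<in> carrier_mat d d"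
    using U by simp
  have "mat_adjoint (r \<cdot>\<^sub>m U) = cnj r \<cdot>\<^sub>m mat_adjoint U"
    using U by (intro eq_matI) auto
  then have "mat_adjoint (r \<cdot>\<^sub>m U) * (r \<cdot>\<^sub>m U) = (cnj r * r) \<cdot>\<^sub>m (mat_adjoint U * U)"
    using U by (simp add: mult_smult_distrib[of _ d d _ d] mult_smult_assoc_mat[of _ d d _ d] smult_smult_mat mult.commute del: U(3))
  also have "cnj r * r = 1"
    using assms(2) by (metis complex_norm_square mult.commute of_real_1 power_one)
  finally show "mat_adjoint (r \<cdot>\<^sub>m U) * (r \<cdot>\<^sub>m U) = 1\<^sub>m d"
    using U by simp
qed

lemma pow_mat_add:
  fixes A :: "'a::semiring_1 mat"
  assumes "A \<in> carrier_mat d d"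
  shows "A ^\<^sub>m (i + j) = A ^\<^sub>m i * A ^\<^sub>m j"
  using assms by (induction j) (auto simp: assoc_mult_mat[of _ d d _ d _ d])

lemma pow_mat_mult:
  fixes A :: "'a::semiring_1 mat"
  assumes "A \<in> carrier_mat d d"
  shows "A ^\<^sub>m (i * j) = (A ^\<^sub>m i) ^\<^sub>m j"
proof (induction j)
  case (Suc j)
  have "A ^\<^sub>m (i * Suc j) = A ^\<^sub>m (i * j) * A ^\<^sub>m i"
    using pow_mat_add[OF assms, of "i * j" i] by (simp add: add.commute)
  then show ?case
    using Suc by simp
qed (use assms in simp)

lemma smult_pow_mat:
  fixes A :: "'a::comm_semiring_1 mat"
  assumes "A \<in> carrier_mat d d"
  shows "(r \<cdot>\<^sub>m A) ^\<^sub>m k = r ^ k \<cdot>\<^sub>m A ^\<^sub>m k"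
  using assms
  by (induction k) (auto simp: mult_smult_distrib[of _ d d _ d] mult_smult_assoc_mat[of _ d d _ d]
      smult_smult_mat mult.commute)

section \<open>Columns of unitaries as orthonormal bases\<close>

lemma set_cols_image: "A \<in> carrier_mat m n \<Longrightarrow> set (cols A) = col A ` {..<n}"
  by (auto simp: cols_def)

lemma braket_cols:
  assumes "A \<in> carrier_mat d m" "B \<in> carrier_mat d n" "i < m" "j < n"
  shows "braket (col A i) (col B j) = (mat_adjoint A * B) $$ (i, j)"
  using assms by (auto simp: braket_def scalar_prod_def mult.commute intro!: sum.cong)

lemma braket_unitary_cols:
  assumes "unitary_mat d U" "i < d" "j < d"
  shows "braket (col U i) (col U j) = (if i = j then 1 else 0)"
  using assms braket_cols[of U d d U d] by (simp add: unitary_mat_def)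

lemma braket_swap:
  assumes "a \<in> carrier_vec d" "b \<in> carrier_vec d"
  shows "braket b a = cnj (braket a b)"
  using assms by (auto simp: braket_def scalar_prod_def mult.commute intro!: sum.cong)

lemma orthonormal_basis_cols:
  assumes U: "unitary_mat d U"
  shows "orthonormal_basis d (set (cols U))"
  unfolding orthonormal_basis_def
proof (intro conjI ballI)
  interpret vec_space "TYPE(complex)" d .
  have UC: "U \<in> carrier_mat d d" "mat_adjoint U \<in> carrier_mat d d" "U * mat_adjoint U = 1\<^sub>m d"
    using U by (auto simp: unitary_mat_def)
  have colU: "set (cols U) = col U ` {..<d}"
    by (rule set_cols_image[OF UC(1)])
  have inj: "inj_on (col U) {..<d}"
    using braket_unitary_cols[OF U] by (intro inj_onI) (metis lessThan_iff zero_neq_one)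
  \<comment> \<open>The determinant criterion for linear independence speaks of rows, hence the
    transpose.\<close>
  have "det (U\<^sup>T) \<noteq> 0"
  proof
    assume "det (U\<^sup>T) = 0"
    then have "det (U * mat_adjoint U) = 0"
      using UC det_mult[of U d "mat_adjoint U"] det_transpose[of U d] by simp
    then show False
      using UC by simp
  qed
  then have "lin_indpt (set (cols U))"
    using det_not_0_imp_lin_indpt_rows[of "U\<^sup>T"] UC by simp
  then show "basis (set (cols U))"
    using UC by (intro dim_li_is_basis) (auto simp: dim_is_n colU card_image[OF inj])
  show "braket u v = (if u = v then 1 else 0)" if uv: "u \<in> set (cols U)" "v \<in> set (cols U)" for u v
    using that inj braket_unitary_cols[OF U] by (auto simp: colU dest: inj_onD)
qed

text \<open>All brackets between columns of \<open>U\<^sup>i\<close> and \<open>U\<^sup>j\<close> are entries of \<open>U\<close> to the power \<open>j - i\<close>.\<close>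

lemma cyclic_mubs_of_unitary:
  assumes U: "unitary_mat d U" and "L > 0" and UL: "U ^\<^sub>m L = 1\<^sub>m d" and d: "d > 1"
    and flat: "\<And>k i j. \<lbrakk>0 < k; k < L; i < d; j < d\<rbrakk> \<Longrightarrow> cmod ((U ^\<^sub>m k) $$ (i, j)) = 1 / sqrt d"
  shows "\<exists>B :: nat \<Rightarrow> complex vec set.
           inj_on B {0..<L} \<and> mub_set d (B ` {0..<L}) \<and>
           (\<exists>U. unitary_mat d U \<and>
                (\<forall>j\<in>{0..<L}. (\<lambda>v. U *\<^sub>v v) ` B j = B ((j + 1) mod L)))"
proof -
  define B where "B j = set (cols (U ^\<^sub>m j))" for j
  note UC [simp] = unitary_mat_carrier[OF U]
  have Upow: "U ^\<^sub>m j \<in> carrier_mat d d" for j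
    using unitary_mat_carrier[OF unitary_mat_pow[OF U]] .
  have B: "B j = (\<lambda>i. col (U ^\<^sub>m j) i) ` {..<d}" for j
    unfolding B_def by (rule set_cols_image[OF Upow])
  have Bcar: "v \<in> carrier_vec d" if "v \<in> B j" for v j
    using that Upow[of j] by (auto simp: B)
  have unb: "cmod (braket a b) = 1 / sqrt d"
    if ij: "i < j" "j < L" and ab: "a \<in> B i" "b \<in> B j" for i j a b
  proof -
    obtain x y where xy: "x < d" "y < d" "a = col (U ^\<^sub>m i) x" "b = col (U ^\<^sub>m j) y"
      using ab by (auto simp: B)
    have adj: "mat_adjoint (U ^\<^sub>m i) \<in> carrier_mat d d"
      using Upow[of i] by simp
    have "mat_adjoint (U ^\<^sub>m i) * U ^\<^sub>m j = mat_adjoint (U ^\<^sub>m i) * (U ^\<^sub>m i * U ^\<^sub>m (j - i))"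
      using ij pow_mat_add[OF UC, of i "j - i"] by simp
    also have "\<dots> = mat_adjoint (U ^\<^sub>m i) * U ^\<^sub>m i * U ^\<^sub>m (j - i)"
      by (rule assoc_mult_mat[OF adj Upow Upow, symmetric])
    also have "\<dots> = U ^\<^sub>m (j - i)"
      using unitary_mat_pow[OF U, of i] by (simp add: unitary_mat_def left_mult_one_mat[OF Upow])
    finally have "braket a b = (U ^\<^sub>m (j - i)) $$ (x, y)"
      using xy braket_cols[OF Upow Upow, of x y i j] by simp
    then show ?thesis
      using flat[of "j - i" x y] ij xy by simp
  qed
  have unb': "cmod (braket a b) = 1 / sqrt d"
    if ij: "i \<noteq> j" "i < L" "j < L" and ab: "a \<in> B i" "b \<in> B j" for i j a b
  proof (cases "i < j")
    case False
    then show ?thesis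
      using unb[of j i b a] ij ab braket_swap[OF Bcar Bcar, of a i b j] by (metis complex_mod_cnj nat_neq_iff)
  qed (use unb ij ab in blast)
  \<comment> \<open>A vector shared by two of the bases would have self-bracket 1 and, by
    unbiasedness, \<open>1 / sqrt d\<close>; here \<open>d > 1\<close> enters.\<close>
  have "inj_on B {0..<L}"
  proof (rule inj_onI, rule ccontr)
    fix i j assume ij: "i \<in> {0..<L}" "j \<in> {0..<L}" "B i = B j" "i \<noteq> j"
    define a where "a = col (U ^\<^sub>m i) 0"
    have a: "a \<in> B i"
      using d by (auto simp: B a_def)
    then have "cmod (braket a a) = 1 / sqrt d"
      using unb'[of i j a a] ij by simp
    moreover have "braket a a = 1"
      using braket_unitary_cols[OF unitary_mat_pow[OF U], of 0 0 i] d by (simp add: a_def)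
    ultimately show False
      using d by simp
  qed
  moreover have "mub_set d (B ` {0..<L})"
    unfolding mub_set_def mutually_unbiased_def
  proof (intro conjI ballI impI)
    show "orthonormal_basis d S" if "S \<in> B ` {0..<L}" for S
      using that orthonormal_basis_cols[OF unitary_mat_pow[OF U]] by (auto simp: B_def)
    show "cmod (braket a b) = 1 / sqrt (real d)"
      if "S \<in> B ` {0..<L}" "T \<in> B ` {0..<L}" "S \<noteq> T" "a \<in> S" "b \<in> T" for S T a b
    proof -
      obtain i j where "i < L" "j < L" "S = B i" "T = B j"
        using \<open>S \<in> _\<close> \<open>T \<in> _\<close> by auto
      then show ?thesis
        using unb'[of i j a b] that by blast
    qed
  qed
  moreover have "(\<lambda>v. U *\<^sub>v v) ` B j = B ((j + 1) mod L)" if "j \<in> {0..<L}" for j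
  proof -
    \<comment> \<open>For \<open>j = L - 1\<close> the index wraps around to 0; this is where the
      exact relation \<open>UL\<close> enters, and not just a power that fixes the standard
      basis.\<close>
    have "U ^\<^sub>m ((j + 1) mod L) = U ^\<^sub>m (1 + j)"
    proof (cases "j + 1 = L")
      case True
      then show ?thesis
        using UL UC by (simp add: carrier_matD[OF UC] flip: True)
    qed (use that in simp)
    also have "\<dots> = U * U ^\<^sub>m j"
      using pow_mat_add[OF UC, of 1 j] by (simp add: carrier_matD[OF UC] left_mult_one_mat[OF UC])
    finally show ?thesis
      using Upow[of j] by (auto simp: B image_image col_mult2[OF UC Upow])
  qed
  ultimately show ?thesis
    using U by blast
qed

section \<open>Weyl operators and unitaries that normalize them\<close>

context char2_finite_field
begin

section \<open>Matrices as kernels on the field\<close>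

definition elt :: "nat \<Rightarrow> 'a" where
  "elt = (SOME e. bij_betw e {0..<2 ^ n} F)"

lemma bij_elt: "bij_betw elt {0..<2 ^ n} F"
  unfolding elt_def using someI_ex[OF ex_bij_betw_nat_finite[OF finite_F]] by (simp add: card_F)

lemma elt_in_F [simp]: "i < 2 ^ n \<Longrightarrow> elt i \<in> F"
  using bij_elt by (auto simp: bij_betw_def)

lemma elt_eq_iff [simp]: "i < 2 ^ n \<Longrightarrow> j < 2 ^ n \<Longrightarrow> elt i = elt j \<longleftrightarrow> i = j"
  using bij_elt by (auto simp: bij_betw_def inj_on_def)

lemma elt_surj:
  assumes "x \<in> F"
  obtains i where "i < 2 ^ n" "x = elt i"
proof -
  have "x \<in> elt ` {0..<2 ^ n}"
    using assms bij_elt by (simp add: bij_betw_def)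
  then show thesis
    using that by auto
qed

lemma sum_elt: "(\<Sum>i = 0..<2 ^ n. f (elt i)) = (\<Sum>x\<in>F. f x)"
  by (rule sum.reindex_bij_betw[OF bij_elt])

text \<open>With rows and columns labelled by field elements, products become sums over
  \<open>F\<close>, and the arbitrary enumeration \<open>elt\<close> disappears from all later
  computations.\<close>

definition op_of :: "('a \<Rightarrow> 'a \<Rightarrow> complex) \<Rightarrow> complex mat" where
  "op_of k = mat (2 ^ n) (2 ^ n) (\<lambda>(i, j). k (elt i) (elt j))"

lemma op_of_carrier [simp]: "op_of k \<in> carrier_mat (2 ^ n) (2 ^ n)"
  and op_of_dim [simp]: "dim_row (op_of k) = 2 ^ n" "dim_col (op_of k) = 2 ^ n"
  and op_of_index [simp]: "i < 2 ^ n \<Longrightarrow> j < 2 ^ n \<Longrightarrow> op_of k $$ (i, j) = k (elt i) (elt j)"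
  by (simp_all add: op_of_def)

lemma op_of_eq_iff: "op_of k = op_of l \<longleftrightarrow> (\<forall>x\<in>F. \<forall>y\<in>F. k x y = l x y)"
proof
  assume "op_of k = op_of l"
  then have "k (elt i) (elt j) = l (elt i) (elt j)" if "i < 2 ^ n" "j < 2 ^ n" for i j
    using that op_of_index by metis
  then show "\<forall>x\<in>F. \<forall>y\<in>F. k x y = l x y"
    by (metis elt_surj)
qed (auto intro!: eq_matI)

lemma op_of_cong: "(\<And>x y. x \<in> F \<Longrightarrow> y \<in> F \<Longrightarrow> k x y = l x y) \<Longrightarrow> op_of k = op_of l"
  by (simp add: op_of_eq_iff)

text \<open>Gives a kernel to matrices that are known only as powers or products.\<close>

lemma op_of_surj:
  assumes "A \<in> carrier_mat (2 ^ n) (2 ^ n)"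
  obtains k where "A = op_of k"
proof
  let ?ix = "the_inv_into {0..<2 ^ n} elt"
  have "?ix (elt i) = i" if "i < 2 ^ n" for i
    using that bij_elt by (intro the_inv_into_f_f) (auto simp: bij_betw_def)
  then show "A = op_of (\<lambda>x y. A $$ (?ix x, ?ix y))"
    using assms by (intro eq_matI) auto
qed

lemma op_of_mult: "op_of k * op_of l = op_of (\<lambda>x y. \<Sum>z\<in>F. k x z * l z y)"
  by (intro eq_matI) (auto simp: scalar_prod_def simp flip: sum_elt)

lemma op_of_smult: "c \<cdot>\<^sub>m op_of k = op_of (\<lambda>x y. c * k x y)"
  by (intro eq_matI) auto

lemma op_of_delta: "op_of (\<lambda>x y. if x = y then 1 else 0) = 1\<^sub>m (2 ^ n)"
  by (intro eq_matI) auto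

lemma op_of_adjoint: "mat_adjoint (op_of k) = op_of (\<lambda>x y. cnj (k y x))"
  by (intro eq_matI) auto

lemma unitary_op_ofI:
  assumes "\<And>x y. x \<in> F \<Longrightarrow> y \<in> F \<Longrightarrow> (\<Sum>z\<in>F. cnj (k z x) * k z y) = (if x = y then 1 else 0)"
  shows "unitary_mat (2 ^ n) (op_of k)"
proof (rule unitary_matI)
  show "mat_adjoint (op_of k) * op_of k = 1\<^sub>m (2 ^ n)"
    unfolding op_of_adjoint op_of_mult op_of_delta[symmetric] by (rule op_of_cong) (rule assms)
qed simp

section \<open>Weyl operators, the Fourier transform, phases and permutations\<close>

definition weyl :: "'a \<Rightarrow> 'a \<Rightarrow> complex mat" where
  "weyl a b = op_of (\<lambda>x y. if y = x + a then chi (b * x) else 0)"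

definition fourier :: "complex mat" where
  "fourier = op_of (\<lambda>x y. chi (x * y) / sqrt (2 ^ n))"

definition diag_op :: "('a \<Rightarrow> complex) \<Rightarrow> complex mat" where
  "diag_op f = op_of (\<lambda>x y. if x = y then f x else 0)"

definition perm_op :: "('a \<Rightarrow> 'a) \<Rightarrow> complex mat" where
  "perm_op g = op_of (\<lambda>x y. if x = g y then 1 else 0)"

lemma op_carrier [simp]:
  "weyl a b \<in> carrier_mat (2 ^ n) (2 ^ n)" "fourier \<in> carrier_mat (2 ^ n) (2 ^ n)"
  "diag_op f \<in> carrier_mat (2 ^ n) (2 ^ n)" "perm_op g \<in> carrier_mat (2 ^ n) (2 ^ n)"
  by (simp_all add: weyl_def fourier_def diag_op_def perm_op_def)

lemma swap_translate: "y = x + a \<longleftrightarrow> x = y + (a::'a)"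
  by (metis add.assoc add.right_neutral add_self)

lemma weyl_mult_op: "a \<in> F \<Longrightarrow> weyl a b * op_of k = op_of (\<lambda>x y. chi (b * x) * k (x + a) y)"
  unfolding weyl_def op_of_mult
  by (rule op_of_cong) (simp add: if_distrib[of "\<lambda>u. u * _"] sum.delta' cong: if_cong)

lemma op_mult_weyl: "a \<in> F \<Longrightarrow> op_of k * weyl a b = op_of (\<lambda>x y. k x (y + a) * chi (b * (y + a)))"
  unfolding weyl_def op_of_mult
proof (rule op_of_cong)
  fix x y assume A: "a \<in> F" "x \<in> F" "y \<in> F"
  have "(\<Sum>z\<in>F. k x z * (if y = z + a then chi (b * z) else 0))
      = (\<Sum>z\<in>F. if z = y + a then k x z * chi (b * z) else 0)"
    using swap_translate by (intro sum.cong refl) auto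
  then show "(\<Sum>z\<in>F. k x z * (if y = z + a then chi (b * z) else 0))
      = k x (y + a) * chi (b * (y + a))"
    using A by simp
qed

lemma diag_mult_op: "diag_op f * op_of k = op_of (\<lambda>x y. f x * k x y)"
  unfolding diag_op_def op_of_mult
  by (rule op_of_cong) (simp add: if_distrib[of "\<lambda>u. u * _"] sum.delta' cong: if_cong)

lemma fourier_self_adjoint: "mat_adjoint fourier = fourier"
  unfolding fourier_def op_of_adjoint by (simp add: mult.commute)

lemma unitary_fourier: "unitary_mat (2 ^ n) fourier"
  unfolding fourier_def
proof (rule unitary_op_ofI)
  fix x y assume xy: "x \<in> F" "y \<in> F"
  have sq: "complex_of_real (sqrt (2 ^ n)) * complex_of_real (sqrt (2 ^ n)) = 2 ^ n"
    by (simp flip: of_real_mult)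
  have "(\<Sum>z\<in>F. cnj (chi (z * x) / sqrt (2 ^ n)) * (chi (z * y) / sqrt (2 ^ n)))
      = (\<Sum>z\<in>F. chi (z * (x + y)) / 2 ^ n)"
    using xy by (intro sum.cong refl) (simp add: distrib_left chi_add sq)
  also have "\<dots> = (\<Sum>z\<in>F. chi (z * (x + y))) / 2 ^ n"
    by (simp add: sum_divide_distrib)
  also have "\<dots> = (if x = y then 1 else 0)"
    using xy by (simp add: sum_chi add_eq_0_iff_eq)
  finally show "(\<Sum>z\<in>F. cnj (chi (z * x) / sqrt (2 ^ n)) * (chi (z * y) / sqrt (2 ^ n)))
      = (if x = y then 1 else 0)" .
qed

lemma fourier_fourier: "fourier * fourier = 1\<^sub>m (2 ^ n)"
  using unitary_fourier by (simp add: unitary_mat_def fourier_self_adjoint)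

lemma unitary_diag_op: "(\<And>x. x \<in> F \<Longrightarrow> cmod (f x) = 1) \<Longrightarrow> unitary_mat (2 ^ n) (diag_op f)"
  unfolding diag_op_def
proof (rule unitary_op_ofI)
  fix x y assume f: "\<And>x. x \<in> F \<Longrightarrow> cmod (f x) = 1" and xy: "x \<in> F" "y \<in> F"
  have "(\<Sum>z\<in>F. cnj (if z = x then f z else 0) * (if z = y then f z else 0))
      = (\<Sum>z\<in>F. if z = x then (if x = y then 1 else 0) else 0)"
  proof (intro sum.cong refl)
    fix z assume "z \<in> F"
    then have "cnj (f z) * f z = 1"
      using f by (metis complex_norm_square mult.commute of_real_1 power_one)
    then show "cnj (if z = x then f z else 0) * (if z = y then f z else 0)
        = (if z = x then (if x = y then 1 else 0) else 0)"
      by auto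
  qed
  then show "(\<Sum>z\<in>F. cnj (if z = x then f z else 0) * (if z = y then f z else 0)) = (if x = y then 1 else 0)"
    using xy by simp
qed

lemma unitary_perm_op:
  assumes "g ` F \<subseteq> F" "inj_on g F"
  shows "unitary_mat (2 ^ n) (perm_op g)"
  unfolding perm_op_def
proof (rule unitary_op_ofI)
  fix x y assume xy: "x \<in> F" "y \<in> F"
  have "(\<Sum>z\<in>F. cnj (if z = g x then 1 else 0) * (if z = g y then 1 else 0))
      = (\<Sum>z\<in>F. if z = g x then (if x = y then 1 else (0::complex)) else 0)"
    using assms(2) xy by (intro sum.cong refl) (auto dest: inj_onD)
  then show "(\<Sum>z\<in>F. cnj (if z = g x then 1 else 0) * (if z = g y then 1 else 0))
      = (if x = y then 1 else (0::complex))"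
    using assms(1) xy by auto
qed

text \<open>
  Whether the entries of a unitary \<open>U\<close> are flat, and whether it is scalar up to a Weyl operator,
  can be read off the action \<open>\<sigma>\<close> on Weyl labels.
\<close>

definition normalizes :: "complex mat \<Rightarrow> ('a \<times> 'a \<Rightarrow> 'a \<times> 'a) \<Rightarrow> bool" where
  "normalizes U \<sigma> \<longleftrightarrow> U \<in> carrier_mat (2 ^ n) (2 ^ n) \<and> \<sigma> ` (F \<times> F) \<subseteq> F \<times> F \<and>
     (\<forall>v\<in>F \<times> F. \<exists>c. cmod c = 1 \<and>
        U * case_prod weyl v = c \<cdot>\<^sub>m (case_prod weyl (\<sigma> v) * U))"

lemma case_prod_weyl_carrier [simp]: "case_prod weyl v \<in> carrier_mat (2 ^ n) (2 ^ n)"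
  by (cases v) simp

lemma normalizesD:
  assumes "normalizes U \<sigma>"
  shows "U \<in> carrier_mat (2 ^ n) (2 ^ n)"
    and "v \<in> F \<times> F \<Longrightarrow> \<sigma> v \<in> F \<times> F"
    and "v \<in> F \<times> F \<Longrightarrow> \<exists>c. cmod c = 1 \<and> U * case_prod weyl v = c \<cdot>\<^sub>m (case_prod weyl (\<sigma> v) * U)"
  using assms unfolding normalizes_def by blast+

lemma normalizes_mult:
  assumes U: "normalizes U \<sigma>" and V: "normalizes V \<tau>"
  shows "normalizes (U * V) (\<sigma> \<circ> \<tau>)"
  unfolding normalizes_def
proof (intro conjI ballI)
  have UC: "U \<in> carrier_mat (2 ^ n) (2 ^ n)" and VC: "V \<in> carrier_mat (2 ^ n) (2 ^ n)"
    using normalizesD(1) U V by blast+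
  show "U * V \<in> carrier_mat (2 ^ n) (2 ^ n)"
    using UC VC by simp
  show "(\<sigma> \<circ> \<tau>) ` (F \<times> F) \<subseteq> F \<times> F"
    using normalizesD(2)[OF U] normalizesD(2)[OF V] by (simp only: image_subset_iff o_def) blast
  fix v assume v: "v \<in> F \<times> F"
  let ?W = "case_prod weyl"
  obtain c where c: "cmod c = 1" "V * ?W v = c \<cdot>\<^sub>m (?W (\<tau> v) * V)"
    using normalizesD(3)[OF V v] by blast
  obtain e where e: "cmod e = 1" "U * ?W (\<tau> v) = e \<cdot>\<^sub>m (?W (\<sigma> (\<tau> v)) * U)"
    using normalizesD(3)[OF U normalizesD(2)[OF V v]] by blast
  have "U * V * ?W v = U * (V * ?W v)"
    by (rule assoc_mult_mat[OF UC VC case_prod_weyl_carrier])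
  also have "\<dots> = c \<cdot>\<^sub>m (U * (?W (\<tau> v) * V))"
    unfolding c(2) by (rule mult_smult_distrib[OF UC mult_carrier_mat[OF case_prod_weyl_carrier VC]])
  also have "U * (?W (\<tau> v) * V) = U * ?W (\<tau> v) * V"
    by (rule assoc_mult_mat[OF UC case_prod_weyl_carrier VC, symmetric])
  also have "\<dots> = e \<cdot>\<^sub>m (?W (\<sigma> (\<tau> v)) * U * V)"
    unfolding e(2) by (rule mult_smult_assoc_mat[OF mult_carrier_mat[OF case_prod_weyl_carrier UC] VC])
  also have "?W (\<sigma> (\<tau> v)) * U * V = ?W (\<sigma> (\<tau> v)) * (U * V)"
    by (rule assoc_mult_mat[OF case_prod_weyl_carrier UC VC])
  finally have "U * V * ?W v = (c * e) \<cdot>\<^sub>m (?W ((\<sigma> \<circ> \<tau>) v) * (U * V))"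
    by (simp add: smult_smult_mat)
  then show "\<exists>c. cmod c = 1 \<and> U * V * ?W v = c \<cdot>\<^sub>m (?W ((\<sigma> \<circ> \<tau>) v) * (U * V))"
    using c(1) e(1) by (intro exI[of _ "c * e"]) (simp add: norm_mult)
qed

lemma normalizes_one: "normalizes (1\<^sub>m (2 ^ n)) id"
  unfolding normalizes_def
proof (intro conjI ballI)
  fix v
  show "\<exists>c. cmod c = 1 \<and> 1\<^sub>m (2 ^ n) * case_prod weyl v = c \<cdot>\<^sub>m (case_prod weyl (id v) * 1\<^sub>m (2 ^ n))"
    by (intro exI[of _ 1])
      (simp add: left_mult_one_mat[OF case_prod_weyl_carrier] right_mult_one_mat[OF case_prod_weyl_carrier])
qed auto

lemma normalizes_pow:
  assumes "normalizes U \<sigma>"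
  shows "normalizes (U ^\<^sub>m k) (\<sigma> ^^ k)"
proof (induction k)
  case 0
  have "U ^\<^sub>m 0 = 1\<^sub>m (2 ^ n)"
    using assms by (auto simp: normalizes_def)
  then show ?case
    using normalizes_one by (simp only: funpow.simps)
next
  case (Suc k)
  then show ?case
    using normalizes_mult[OF Suc assms] by (simp only: funpow_Suc_right pow_mat.simps)
qed

lemma normalizes_smult:
  assumes U: "normalizes U \<sigma>"
  shows "normalizes (r \<cdot>\<^sub>m U) \<sigma>"
  unfolding normalizes_def
proof (intro conjI ballI)
  have UC: "U \<in> carrier_mat (2 ^ n) (2 ^ n)"
    using U by (simp add: normalizes_def)
  then show "r \<cdot>\<^sub>m U \<in> carrier_mat (2 ^ n) (2 ^ n)"
    by simp
  show "\<sigma> ` (F \<times> F) \<subseteq> F \<times> F"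
    using U by (simp add: normalizes_def)
  fix v assume v: "v \<in> F \<times> F"
  obtain c where c: "cmod c = 1" "U * case_prod weyl v = c \<cdot>\<^sub>m (case_prod weyl (\<sigma> v) * U)"
    using normalizesD(3)[OF U v] by blast
  have "r \<cdot>\<^sub>m U * case_prod weyl v = r \<cdot>\<^sub>m (U * case_prod weyl v)"
    by (rule mult_smult_assoc_mat[OF UC case_prod_weyl_carrier])
  also have "\<dots> = c \<cdot>\<^sub>m (r \<cdot>\<^sub>m (case_prod weyl (\<sigma> v) * U))"
    by (simp add: c(2) smult_smult_mat mult.commute)
  also have "r \<cdot>\<^sub>m (case_prod weyl (\<sigma> v) * U) = case_prod weyl (\<sigma> v) * (r \<cdot>\<^sub>m U)"
    by (rule mult_smult_distrib[OF case_prod_weyl_carrier UC, symmetric])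
  finally show "\<exists>c. cmod c = 1 \<and> r \<cdot>\<^sub>m U * case_prod weyl v = c \<cdot>\<^sub>m (case_prod weyl (\<sigma> v) * (r \<cdot>\<^sub>m U))"
    using c(1) by blast
qed

text \<open>The last premise is the intertwining relation compared entry by entry. The phase
  \<open>c a b\<close> may depend on the label but not on the entry.\<close>

lemma normalizes_op_ofI:
  assumes "\<sigma> ` (F \<times> F) \<subseteq> F \<times> F"
    and "\<And>a b. a \<in> F \<Longrightarrow> b \<in> F \<Longrightarrow> cmod (c a b) = 1"
    and "\<And>a b x y. \<lbrakk>a \<in> F; b \<in> F; x \<in> F; y \<in> F\<rbrakk> \<Longrightarrow>
      k x (y + a) * chi (b * (y + a)) = c a b * (chi (snd (\<sigma> (a, b)) * x) * k (x + fst (\<sigma> (a, b))) y)"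
  shows "normalizes (op_of k) \<sigma>"
  unfolding normalizes_def
proof (intro conjI ballI)
  fix v assume v: "v \<in> F \<times> F"
  obtain a b where ab: "v = (a, b)" "a \<in> F" "b \<in> F"
    using v by blast
  obtain a' b' where ab': "\<sigma> (a, b) = (a', b')"
    by (cases "\<sigma> (a, b)")
  have "\<sigma> (a, b) \<in> F \<times> F"
    using assms(1) ab by blast
  then have a': "a' \<in> F"
    by (simp add: ab')
  have "op_of k * case_prod weyl v = c a b \<cdot>\<^sub>m (case_prod weyl (\<sigma> v) * op_of k)"
    unfolding ab(1) ab' prod.case op_mult_weyl[OF ab(2)] weyl_mult_op[OF a'] op_of_smult
    by (rule op_of_cong) (use assms(3)[OF ab(2,3)] ab ab' in simp)
  then show "\<exists>c. cmod c = 1 \<and> op_of k * case_prod weyl v = c \<cdot>\<^sub>m (case_prod weyl (\<sigma> v) * op_of k)"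
    using assms(2)[OF ab(2,3)] by blast
qed (use assms(1) in auto)

text \<open>The Fourier transform exchanges translations and modulations. The minus sign of the
  usual quarter turn vanishes in characteristic 2, and reordering the two parts costs the phase
  \<open>chi (a * b)\<close>.\<close>

lemma normalizes_fourier: "normalizes fourier (\<lambda>(a, b). (b, a))"
  unfolding fourier_def
proof (rule normalizes_op_ofI)
  fix a b x y assume A: "a \<in> F" "b \<in> F" "x \<in> F" "y \<in> F"
  have "chi (x * (y + a)) * chi (b * (y + a)) = chi (a * b) * (chi (a * x) * chi ((x + b) * y))"
    using A by (simp add: distrib_left distrib_right chi_add mult.commute mult.left_commute)
  then show "chi (x * (y + a)) / sqrt (2 ^ n) * chi (b * (y + a))
      = chi (a * b) * (chi (snd (case (a, b) of (a, b) \<Rightarrow> (b, a)) * x) *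
        (chi ((x + fst (case (a, b) of (a, b) \<Rightarrow> (b, a))) * y) / sqrt (2 ^ n)))"
    by (simp add: field_simps)
qed auto

text \<open>Moving \<open>f\<close> past a translation compares \<open>f x\<close> with
  \<open>f (x + a)\<close>. Their ratio is the constant \<open>f a\<close> times the character
  \<open>chi (s * x * a)\<close>, and that character is an additional modulation by
  \<open>s * a\<close>.\<close>

lemma normalizes_diag_op:
  assumes s: "s \<in> F" and f: "\<And>x. x \<in> F \<Longrightarrow> cmod (f x) = 1"
    and add: "\<And>x y. x \<in> F \<Longrightarrow> y \<in> F \<Longrightarrow> f (x + y) = f x * f y * chi (s * x * y)"
  shows "normalizes (diag_op f) (\<lambda>(a, b). (a, b + s * a))"
  unfolding diag_op_def
proof (rule normalizes_op_ofI[where c = "\<lambda>a b. inverse (f a)"])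
  fix a b x y assume A: "a \<in> F" "b \<in> F" "x \<in> F" "y \<in> F"
  have "f a \<noteq> 0"
    using f[OF A(1)] by auto
  moreover have "chi ((b + s * a) * x) * chi (s * x * a) = chi (b * x)"
  proof -
    have "(b + s * a) * x = b * x + s * x * a"
      by (simp add: algebra_simps)
    then show ?thesis
      using A s by (simp add: chi_add mult.assoc)
  qed
  ultimately have "f x * chi (b * x) = inverse (f a) * (chi ((b + s * a) * x) * f (x + a))"
    using A add[of x a] by (simp add: field_simps)
  then show "(if x = y + a then f x else 0) * chi (b * (y + a))
     = inverse (f a) * (chi (snd (case (a, b) of (a, b) \<Rightarrow> (a, b + s * a)) * x)
        * (if x + fst (case (a, b) of (a, b) \<Rightarrow> (a, b + s * a)) = y
           then f (x + fst (case (a, b) of (a, b) \<Rightarrow> (a, b + s * a))) else 0))"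
    using swap_translate[of y x a] by auto
qed (use s f in \<open>auto simp: norm_inverse\<close>)

text \<open>Since \<open>chi\<close> is invariant under the Frobenius map, the modulation label is
  transformed like the translation label and no phase appears.\<close>

lemma normalizes_frobenius:
  "normalizes (perm_op (\<lambda>x. x ^ 2 ^ k)) (\<lambda>(a, b). (a ^ 2 ^ k, b ^ 2 ^ k))"
  unfolding perm_op_def
proof (rule normalizes_op_ofI[where c = "\<lambda>_ _. 1"])
  fix a b x y assume A: "a \<in> F" "b \<in> F" "x \<in> F" "y \<in> F"
  have "chi (b ^ 2 ^ k * (y + a) ^ 2 ^ k) = chi (b * (y + a))"
    using A chi_frobenius[of "b * (y + a)" k] by (simp add: power_mult_distrib)
  moreover have "x = (y + a) ^ 2 ^ k \<longleftrightarrow> x + a ^ 2 ^ k = y ^ 2 ^ k"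
    unfolding frobenius_add using swap_translate by metis
  ultimately show "(if x = (y + a) ^ 2 ^ k then 1 else 0) * chi (b * (y + a))
     = 1 * (chi (snd (case (a, b) of (a, b) \<Rightarrow> (a ^ 2 ^ k, b ^ 2 ^ k)) * x)
        * (if x + fst (case (a, b) of (a, b) \<Rightarrow> (a ^ 2 ^ k, b ^ 2 ^ k)) = y ^ 2 ^ k then 1 else 0))"
    by auto
qed auto

text \<open>
  The columns of \<open>V\<close> are common eigenvectors of Weyl operators whose translation parts
  exhaust the field.
\<close>

lemma flat_entries:
  assumes V: "unitary_mat (2 ^ n) V" and norm: "normalizes V \<sigma>"
    and surj: "F \<subseteq> (\<lambda>b. fst (\<sigma> (0, b))) ` F" and ij: "i < 2 ^ n" "j < 2 ^ n"
  shows "cmod (V $$ (i, j)) = 1 / sqrt (real (2 ^ n))"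
proof -
  obtain v where v: "V = op_of v"
    using op_of_surj[OF unitary_mat_carrier[OF V]] .
  define y where "y = elt j"
  have y: "y \<in> F"
    using ij by (simp add: y_def)
  \<comment> \<open>The operator \<open>weyl 0 b\<close> is diagonal, so on the right of
    \<open>V\<close> it only changes signs of columns, while \<open>weyl a b'\<close> on the left
    shifts the row index by \<open>a\<close>. All other factors have modulus 1.\<close>
  have trans: "cmod (v x y) = cmod (v (x + a) y)" if xa: "x \<in> F" "a \<in> F" for x a
  proof -
    obtain b where b: "b \<in> F" "a = fst (\<sigma> (0, b))"
      using surj xa by blast
    obtain b' where b': "\<sigma> (0, b) = (a, b')"
      using b by (metis prod.collapse)
    obtain c where c: "cmod c = 1" "V * weyl 0 b = c \<cdot>\<^sub>m (weyl a b' * V)"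
      using normalizesD(3)[OF norm, of "(0, b)"] b(1) b' by auto
    have "v x y * chi (b * y) = c * (chi (b' * x) * v (x + a) y)"
      using c(2) xa y unfolding v op_mult_weyl[OF F_zero] weyl_mult_op[OF xa(2)] op_of_smult op_of_eq_iff
      by simp
    then have "cmod (v x y * chi (b * y)) = cmod (c * (chi (b' * x) * v (x + a) y))"
      by simp
    then show ?thesis
      by (simp add: norm_mult c(1))
  qed
  \<comment> \<open>Shifting by \<open>x\<close> itself leads to row 0, because
    \<open>x + x = 0\<close>.\<close>
  have const: "cmod (v x y) = cmod (v 0 y)" if "x \<in> F" for x
    using trans[OF that that] by simp
  have "mat_adjoint V * V = op_of (\<lambda>x y. if x = y then 1 else 0)"
    using V by (simp add: unitary_mat_def op_of_delta)
  then have "(\<Sum>z\<in>F. cnj (v z y) * v z y) = 1"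
    using y unfolding v op_of_adjoint op_of_mult op_of_eq_iff by fastforce
  moreover have "(\<Sum>z\<in>F. cnj (v z y) * v z y) = (\<Sum>z\<in>F. complex_of_real ((cmod (v 0 y))\<^sup>2))"
    using const by (intro sum.cong refl) (metis complex_norm_square mult.commute)
  ultimately have "complex_of_real (2 ^ n * (cmod (v 0 y))\<^sup>2) = 1"
    by (simp add: card_F)
  then have "2 ^ n * (cmod (v 0 y))\<^sup>2 = 1"
    using of_real_eq_1_iff by blast
  then have "(cmod (v 0 y))\<^sup>2 = (1 / sqrt (2 ^ n))\<^sup>2"
    by (simp add: field_simps power_divide)
  then have "cmod (v 0 y) = 1 / sqrt (2 ^ n)"
    by (rule power2_eq_imp_eq) simp_all
  then show ?thesis
    using const[of "elt i"] ij by (simp add: v y_def)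
qed

text \<open>Restricted to pure translations and pure modulations: a general \<open>weyl a b\<close>
  squares to the sign \<open>chi (a * b)\<close>.\<close>

lemma weyl_involution: "a \<in> F \<Longrightarrow> weyl a 0 * weyl a 0 = 1\<^sub>m (2 ^ n)" "weyl 0 b * weyl 0 b = 1\<^sub>m (2 ^ n)"
proof -
  show "weyl a 0 * weyl a 0 = 1\<^sub>m (2 ^ n)" if "a \<in> F"
    unfolding weyl_def[of a] op_of_delta[symmetric] unfolding weyl_mult_op[OF that] weyl_def[symmetric]
    unfolding weyl_def op_of_mult
    using that by (intro op_of_cong) (simp add: add.assoc if_distrib[of "\<lambda>u. u * _"] cong: if_cong)
  show "weyl 0 b * weyl 0 b = 1\<^sub>m (2 ^ n)"
    unfolding weyl_def op_of_delta[symmetric] op_of_mult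
    by (intro op_of_cong) (simp add: if_distrib[of "\<lambda>u. u * _"] cong: if_cong)
qed

text \<open>
  By irreducibility of the Weyl operators: \<open>S\<close> commutes up to signs with the involutive
  generators, hence its square commutes with them.
\<close>

lemma square_scalar:
  assumes S: "unitary_mat (2 ^ n) S" and norm: "normalizes S \<sigma>"
    and id: "\<And>v. v \<in> F \<times> F \<Longrightarrow> \<sigma> v = v"
  obtains \<theta> where "cmod \<theta> = 1" "S * S = \<theta> \<cdot>\<^sub>m 1\<^sub>m (2 ^ n)"
proof -
  let ?I = "1\<^sub>m (2 ^ n) :: complex mat"
  note SC = unitary_mat_carrier[OF S]
  have SS: "unitary_mat (2 ^ n) (S * S)"
    by (rule unitary_mat_mult[OF S S])
  note SSC = unitary_mat_carrier[OF SS]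
  have commute: "S * S * W = W * (S * S)"
    if W: "W = case_prod weyl v" "v \<in> F \<times> F" "W * W = ?I" for W v
  proof -
    have WC: "W \<in> carrier_mat (2 ^ n) (2 ^ n)"
      by (simp add: W(1))
    obtain c where c: "S * W = c \<cdot>\<^sub>m (W * S)"
      using normalizesD(3)[OF norm W(2)] unfolding id[OF W(2)] W(1) by blast
    have SW: "S * (W * M) = c \<cdot>\<^sub>m (W * (S * M))" if M: "M \<in> carrier_mat (2 ^ n) (2 ^ n)" for M
    proof -
      have "S * (W * M) = c \<cdot>\<^sub>m (W * S) * M"
        unfolding c[symmetric] by (rule assoc_mult_mat[OF SC WC M, symmetric])
      also have "\<dots> = c \<cdot>\<^sub>m (W * S * M)"
        by (rule mult_smult_assoc_mat[OF mult_carrier_mat[OF WC SC] M])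
      also have "W * S * M = W * (S * M)"
        by (rule assoc_mult_mat[OF WC SC M])
      finally show ?thesis .
    qed
    \<comment> \<open>Passing the two factors of \<open>W * W = 1\<close> through \<open>S\<close>
      one after the other yields \<open>c\<close> twice, so \<open>c\<close> is a sign and
      \<open>S * S\<close> commutes with \<open>W\<close>.\<close>
    have "S = S * (W * W)"
      by (simp add: W(3) right_mult_one_mat[OF SC])
    also have "\<dots> = c \<cdot>\<^sub>m (W * (c \<cdot>\<^sub>m (W * S)))"
      unfolding SW[OF WC] c ..
    also have "W * (c \<cdot>\<^sub>m (W * S)) = c \<cdot>\<^sub>m (W * (W * S))"
      by (rule mult_smult_distrib[OF WC mult_carrier_mat[OF WC SC]])
    also have "W * (W * S) = W * W * S"
      by (rule assoc_mult_mat[OF WC WC SC, symmetric])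
    also have "\<dots> = S"
      by (simp add: W(3) left_mult_one_mat[OF SC])
    finally have "S = (c * c) \<cdot>\<^sub>m S"
      by (simp add: smult_smult_mat)
    then have "mat_adjoint S * S = mat_adjoint S * ((c * c) \<cdot>\<^sub>m S)"
      by simp
    also have "\<dots> = (c * c) \<cdot>\<^sub>m (mat_adjoint S * S)"
      by (rule mult_smult_distrib[OF mat_adjoint_carrier[OF SC] SC])
    finally have "?I = (c * c) \<cdot>\<^sub>m ?I"
      using S by (simp add: unitary_mat_def)
    then have "?I $$ (0, 0) = ((c * c) \<cdot>\<^sub>m ?I) $$ (0, 0)"
      by simp
    then have cc: "c * c = 1"
      by simp
    have "S * S * W = S * (S * W)"
      by (rule assoc_mult_mat[OF SC SC WC])
    also have "\<dots> = c \<cdot>\<^sub>m (S * (W * S))"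
      unfolding c by (rule mult_smult_distrib[OF SC mult_carrier_mat[OF WC SC]])
    also have "\<dots> = W * (S * S)"
      unfolding SW[OF SC] smult_smult_mat cc by simp
    finally show ?thesis .
  qed
  obtain s where s: "S * S = op_of s"
    using op_of_surj[OF SSC] .
  \<comment> \<open>Commuting with translations makes the kernel constant along the diagonal;
    commuting with modulations makes it vanish off the diagonal.\<close>
  have X: "s x (y + a) = s (x + a) y" if "x \<in> F" "y \<in> F" "a \<in> F" for x y a
    using commute[of "weyl a 0" "(a, 0)"] that weyl_involution(1)[of a]
    by (auto simp: s op_mult_weyl weyl_mult_op op_of_eq_iff)
  have Z: "s x y * chi (b * y) = chi (b * x) * s x y" if "x \<in> F" "y \<in> F" "b \<in> F" for x y b
    using commute[of "weyl 0 b" "(0, b)"] that weyl_involution(2)[of b]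
    by (auto simp: s op_mult_weyl weyl_mult_op op_of_eq_iff)
  have off: "s x y = 0" if xy: "x \<in> F" "y \<in> F" "x \<noteq> y" for x y
  proof -
    obtain b where b: "b \<in> F" "chi (b * (x + y)) = - 1"
      using chi_nondegenerate[of "x + y"] xy by (auto simp: add_eq_0_iff_eq)
    then have "chi (b * x) = - chi (b * y)"
      using chi_cases[of "b * x"] chi_cases[of "b * y"] xy by (auto simp: distrib_left chi_add)
    then have "s x y * chi (b * y) = 0"
      using Z[OF xy(1,2) b(1)] by (simp add: mult.commute)
    then show ?thesis
      using chi_cases[of "b * y"] by auto
  qed
  have diag: "s x x = s 0 0" if "x \<in> F" for x
    using X[of x 0 x] that by simp
  have scalar: "S * S = s 0 0 \<cdot>\<^sub>m ?I"
    unfolding s op_of_delta[symmetric] op_of_smult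
  proof (rule op_of_cong)
    show "s x y = s 0 0 * (if x = y then 1 else 0)" if "x \<in> F" "y \<in> F" for x y
      using off[OF that] diag[OF that(1)] by (cases "x = y") simp_all
  qed
  have "braket (col (S * S) 0) (col (S * S) 0) = 1"
    using braket_unitary_cols[OF SS, of 0 0] by simp
  then have "cnj (s 0 0) * s 0 0 = 1"
    unfolding scalar by (simp add: braket_def mult.commute)
  then have "(cmod (s 0 0))\<^sup>2 = 1"
    by (metis complex_norm_square mult.commute of_real_eq_1_iff)
  then have "cmod (s 0 0) = 1"
    using norm_ge_zero[of "s 0 0"] unfolding power2_eq_1_iff by linarith
  with scalar show thesis
    using that by blast
qed

end

section \<open>The two cyclic unitaries\<close>

lemma funpow_fixpoint_mult: "(f ^^ k) x = x \<Longrightarrow> (f ^^ (k * j)) x = x"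
  by (induction j) (simp_all add: funpow_add)

text \<open>By Bezout over the naturals, a multiple of \<open>k\<close> exceeds a multiple of
  \<open>l\<close> by one; both iterates fix \<open>x\<close>, hence so does the one surplus
  application.\<close>

lemma funpow_fixpoint_coprime:
  assumes "coprime k l" "(f ^^ k) x = x" "(f ^^ l) x = x"
  shows "f x = x"
proof (cases "k = 0")
  case False
  then obtain i j where "k * i = l * j + 1"
    using bezout_nat[of k l] assms(1) by auto
  then have "f ((f ^^ (l * j)) x) = (f ^^ (k * i)) x"
    by simp
  then show ?thesis
    using funpow_fixpoint_mult[OF assms(2)] funpow_fixpoint_mult[OF assms(3)] by simp
qed (use assms in simp)

lemma funpow_power: "((\<lambda>x. x ^ m) ^^ k) x = (x :: 'a::monoid_mult) ^ (m ^ k)"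
  by (induction k) (simp_all add: power_mult[symmetric] mult.commute)

context char2_finite_field
begin

lemma perm_op_mult:
  assumes "h ` F \<subseteq> F"
  shows "perm_op g * perm_op h = perm_op (g \<circ> h)"
  unfolding perm_op_def op_of_mult
proof (rule op_of_cong)
  fix x y assume "x \<in> F" "y \<in> F"
  then have "h y \<in> F"
    using assms by blast
  have "(\<Sum>z\<in>F. (if x = g z then 1 else 0) * (if z = h y then 1 else 0))
      = (\<Sum>z\<in>F. if z = h y then (if x = g (h y) then 1 else (0::complex)) else 0)"
    by (intro sum.cong refl) auto
  then show "(\<Sum>z\<in>F. (if x = g z then 1 else 0) * (if z = h y then 1 else 0))
      = (if x = (g \<circ> h) y then 1 else (0::complex))"
    using \<open>h y \<in> F\<close> by simp
qed

lemma perm_op_pow: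
  assumes "h ` F \<subseteq> F"
  shows "perm_op h ^\<^sub>m k = perm_op (h ^^ k)"
proof (induction k)
  case 0
  then show ?case
    by (simp add: perm_op_def op_of_delta)
next
  case (Suc k)
  then show ?case
    using perm_op_mult[OF assms, of "h ^^ k"] by (simp only: funpow_Suc_right pow_mat.simps)
qed

lemma diag_op_inverse:
  assumes "\<And>x. x \<in> F \<Longrightarrow> f x * g x = 1"
  shows "diag_op f * diag_op g = 1\<^sub>m (2 ^ n)"
  unfolding diag_op_def[of g] diag_mult_op op_of_delta[symmetric]
  by (rule op_of_cong) (simp add: assms)

text \<open>The conjugate phase gives the same shear because \<open>chi\<close> is real; this
  matches the fact that a shear in characteristic 2 is its own inverse.\<close>

lemma normalizes_diag_quarter:
  assumes "t \<in> F"
  shows "normalizes (diag_op (\<lambda>x. quarter (t * x))) (\<lambda>(a, b). (a, b + t\<^sup>2 * a))"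
    and "normalizes (diag_op (\<lambda>x. cnj (quarter (t * x)))) (\<lambda>(a, b). (a, b + t\<^sup>2 * a))"
proof -
  have *: "quarter (t * (x + y)) = quarter (t * x) * quarter (t * y) * chi (t\<^sup>2 * x * y)"
    if "x \<in> F" "y \<in> F" for x y
    using assms that by (simp add: distrib_left quarter_add power2_eq_square mult_ac)
  show "normalizes (diag_op (\<lambda>x. quarter (t * x))) (\<lambda>(a, b). (a, b + t\<^sup>2 * a))"
    by (rule normalizes_diag_op) (use assms * in auto)
  show "normalizes (diag_op (\<lambda>x. cnj (quarter (t * x)))) (\<lambda>(a, b). (a, b + t\<^sup>2 * a))"
    by (rule normalizes_diag_op) (use assms * in auto)
qed

lemma frobenius_surj:
  assumes "y \<in> F"
  obtains x where "x \<in> F" "x ^ 2 ^ k = y"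
proof -
  have "(\<lambda>x. x ^ 2 ^ k) ` F = F"
    by (rule endo_inj_surj) (auto intro!: inj_onI simp: frobenius_inj)
  then have "y \<in> (\<lambda>x. x ^ 2 ^ k) ` F"
    using assms by simp
  then show thesis
    by (rule imageE) (rule that, auto)
qed

text \<open>
  The Frobenius map \<open>x \<mapsto> x ^ 2 ^ m\<close> permutes the maximal commuting Weyl classes
  \<open>{(b, s b)}\<close> by acting on the slope \<open>s\<close>. The unitary \<open>G\<close> carries the class
  \<open>{(0, b)}\<close> of the standard basis to the class of slope \<open>s\<close>.
\<close>

lemma cyclic_unitary_frobenius:
  assumes L: "prime L" and n: "n = m * L"
  shows "\<exists>U. unitary_mat (2 ^ n) U \<and> U ^\<^sub>m L = 1\<^sub>m (2 ^ n) \<and>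
    (\<forall>k i j. 0 < k \<longrightarrow> k < L \<longrightarrow> i < 2 ^ n \<longrightarrow> j < 2 ^ n \<longrightarrow>
      cmod ((U ^\<^sub>m k) $$ (i, j)) = 1 / sqrt (real (2 ^ n)))"
proof -
  have m: "m > 0"
    using n n_pos by (cases m) auto
  have "m < n"
    using n m prime_gt_1_nat[OF L] by simp
  \<comment> \<open>The fixed field of the Frobenius power has only \<open>2 ^ m\<close> elements,
    so some slope \<open>s\<close> is moved.\<close>
  then have "card {x::'a. x ^ 2 ^ m = x} < card F"
    using finite_card_frobenius_fixed(2)[OF m] by (simp add: card_F)
  then have "\<not> F \<subseteq> {x. x ^ 2 ^ m = x}"
    using card_mono[OF finite_card_frobenius_fixed(1)[OF m]] leD by blast
  then obtain s where s: "s \<in> F" "s ^ 2 ^ m \<noteq> s"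
    by blast
  obtain t where t: "t \<in> F" "t\<^sup>2 = s"
    using F_square_root[OF s(1)] .
  define \<phi> where "\<phi> = (\<lambda>x::'a. x ^ 2 ^ m)"
  have \<phi>_pow: "(\<phi> ^^ k) x = x ^ 2 ^ (m * k)" for k x
    unfolding \<phi>_def funpow_power by (simp add: power_mult)
  have \<phi>_F: "\<phi> ` F \<subseteq> F"
    by (auto simp: \<phi>_def)
  \<comment> \<open>The orbit of \<open>s\<close> has the full prime length \<open>L\<close>: a
    shorter return time would be coprime to \<open>L\<close> and make \<open>s\<close> a fixed
    point.\<close>
  have slope: "s ^ 2 ^ (m * k) \<noteq> s" if k: "0 < k" "k < L" for k
  proof
    assume "s ^ 2 ^ (m * k) = s"
    then have "(\<phi> ^^ k) s = s"
      unfolding \<phi>_pow .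
    moreover have "(\<phi> ^^ L) s = s"
      unfolding \<phi>_pow n[symmetric] by (rule F_pow_card[OF s(1)])
    moreover have "coprime k L"
      using prime_imp_coprime[OF L, of k] nat_dvd_not_less[OF k] by (simp add: coprime_commute)
    ultimately have "\<phi> s = s"
      by (intro funpow_fixpoint_coprime)
    then show False
      using s(2) by (simp add: \<phi>_def)
  qed
  define P where "P = perm_op \<phi>"
  define D where "D = diag_op (\<lambda>x. quarter (t * x))"
  define D' where "D' = diag_op (\<lambda>x. cnj (quarter (t * x)))"
  \<comment> \<open>\<open>P\<close> alone merely permutes the standard basis vectors. Conjugation
    by \<open>G\<close> lets the standard basis stand for the class of slope \<open>s\<close>, which
    the Frobenius power moves.\<close>
  define G where "G = D * fourier"
  define G' where "G' = fourier * D'"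
  define U where "U = G' * P * G"
  have carr: "P \<in> carrier_mat (2 ^ n) (2 ^ n)" "D \<in> carrier_mat (2 ^ n) (2 ^ n)"
      "D' \<in> carrier_mat (2 ^ n) (2 ^ n)"
    by (simp_all add: P_def D_def D'_def)
  note F_carr = op_carrier(2)
  have G_carr: "G \<in> carrier_mat (2 ^ n) (2 ^ n)" "G' \<in> carrier_mat (2 ^ n) (2 ^ n)"
    unfolding G_def G'_def
    by (rule mult_carrier_mat[OF carr(2) F_carr], rule mult_carrier_mat[OF F_carr carr(3)])
  have mod1: "quarter x * cnj (quarter x) = 1" for x
    using complex_norm_square[of "quarter x"] by simp
  have DD': "D * D' = 1\<^sub>m (2 ^ n)" "D' * D = 1\<^sub>m (2 ^ n)"
    unfolding D_def D'_def by (rule diag_op_inverse, simp add: mod1 mult.commute)+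
  have "G * G' = D * (fourier * (fourier * D'))"
    unfolding G_def G'_def by (rule assoc_mult_mat[OF carr(2) F_carr mult_carrier_mat[OF F_carr carr(3)]])
  also have "fourier * (fourier * D') = D'"
    using assoc_mult_mat[OF F_carr F_carr carr(3)] by (simp add: fourier_fourier left_mult_one_mat[OF carr(3)])
  finally have GG': "G * G' = 1\<^sub>m (2 ^ n)"
    by (simp add: DD')
  then have G'G: "G' * G = 1\<^sub>m (2 ^ n)"
    using mat_mult_left_right_inverse[OF G_carr] by simp
  have "similar_mat_wit U P G' G"
    using mult_carrier_mat[OF mult_carrier_mat[OF G_carr(2) carr(1)] G_carr(1)]
    by (intro similar_mat_witI[OF G'G GG' U_def _ carr(1) G_carr(2,1)]) (simp add: U_def)
  then have U_pow: "U ^\<^sub>m k = G' * P ^\<^sub>m k * G" for k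
    by (rule similar_mat_wit_pow_id)
  have "P ^\<^sub>m L = 1\<^sub>m (2 ^ n)"
    unfolding P_def perm_op_pow[OF \<phi>_F] op_of_delta[symmetric] unfolding perm_op_def
    by (rule op_of_cong) (simp add: \<phi>_pow F_pow_card flip: n)
  then have UL: "U ^\<^sub>m L = 1\<^sub>m (2 ^ n)"
    by (simp add: U_pow right_mult_one_mat[OF G_carr(2)] G'G)
  have unitaries: "unitary_mat (2 ^ n) D" "unitary_mat (2 ^ n) D'" "unitary_mat (2 ^ n) P"
    unfolding D_def D'_def P_def
    by (auto intro!: unitary_diag_op unitary_perm_op inj_onI simp: \<phi>_def frobenius_inj)
  have U: "unitary_mat (2 ^ n) U"
    unfolding U_def G_def G'_def by (intro unitary_mat_mult unitaries unitary_fourier)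
  have flat: "cmod ((U ^\<^sub>m k) $$ (i, j)) = 1 / sqrt (real (2 ^ n))"
    if k: "0 < k" "k < L" and ij: "i < 2 ^ n" "j < 2 ^ n" for k i j
  proof (rule flat_entries[OF unitary_mat_pow[OF U] _ _ ij])
    have Pk: "P ^\<^sub>m k = perm_op (\<lambda>x. x ^ 2 ^ (m * k))"
      unfolding P_def perm_op_pow[OF \<phi>_F] by (rule arg_cong[of _ _ perm_op]) (simp add: fun_eq_iff \<phi>_pow)
    define \<delta> where "\<delta> = (\<lambda>(a, b). (a, b + s * a))"
    define \<epsilon> where "\<epsilon> = (\<lambda>(a :: 'a, b :: 'a). (b, a))"
    define \<psi> where "\<psi> = (\<lambda>(a :: 'a, b :: 'a). (a ^ 2 ^ (m * k), b ^ 2 ^ (m * k)))"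
    have "normalizes D \<delta>" "normalizes D' \<delta>"
      unfolding D_def D'_def \<delta>_def using normalizes_diag_quarter[OF t(1)] t(2) by simp_all
    then show "normalizes (U ^\<^sub>m k) ((\<epsilon> \<circ> \<delta>) \<circ> \<psi> \<circ> (\<delta> \<circ> \<epsilon>))"
      unfolding U_pow G_def G'_def Pk \<psi>_def \<epsilon>_def
      by (intro normalizes_mult normalizes_fourier normalizes_frobenius)
    \<comment> \<open>The label \<open>(0, b)\<close> goes to slope \<open>s\<close>, then to the
      Frobenius image of \<open>s\<close>, and is measured again relative to \<open>s\<close>. The
      factor is the difference of the two slopes, nonzero by \<open>slope\<close>, and the power of
      \<open>b\<close> runs through \<open>F\<close> because the Frobenius map is bijective.\<close>
    have fst_eq: "fst (((\<epsilon> \<circ> \<delta>) \<circ> \<psi> \<circ> (\<delta> \<circ> \<epsilon>)) (0, b))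
        = (s ^ 2 ^ (m * k) + s) * b ^ 2 ^ (m * k)" for b
      by (simp add: \<epsilon>_def \<delta>_def \<psi>_def power_mult_distrib distrib_right)
    show "F \<subseteq> (\<lambda>b. fst (((\<epsilon> \<circ> \<delta>) \<circ> \<psi> \<circ> (\<delta> \<circ> \<epsilon>)) (0, b))) ` F"
    proof
      fix y assume y: "y \<in> F"
      have nz: "s ^ 2 ^ (m * k) + s \<noteq> 0"
        using slope[OF k] by (simp add: add_eq_0_iff_eq)
      have "y / (s ^ 2 ^ (m * k) + s) \<in> F"
        using y s(1) by simp
      then obtain b where "b \<in> F" "b ^ 2 ^ (m * k) = y / (s ^ 2 ^ (m * k) + s)"
        using frobenius_surj by blast
      then show "y \<in> (\<lambda>b. fst (((\<epsilon> \<circ> \<delta>) \<circ> \<psi> \<circ> (\<delta> \<circ> \<epsilon>)) (0, b))) ` F"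
        using nz unfolding fst_eq by (intro image_eqI[of _ _ b]) simp_all
    qed
  qed
  show ?thesis
    using U UL flat by blast
qed

text \<open>Take a root of \<open>1 + X + ... + X^(L - 1)\<close>. It differs from 1 because the
  value there is \<open>L\<close>, which is odd and so equals 1 in the field.\<close>

lemma root_of_unity_exists:
  assumes "odd L" "L > 1"
  obtains \<zeta> :: 'a where "\<zeta> ^ L = 1" "\<zeta> \<noteq> 1"
proof -
  obtain \<zeta> :: 'a where "(\<Sum>k\<le>L - 1. 1 * \<zeta> ^ k) = 0"
    using alg_closed[of "L - 1" "\<lambda>_. 1"] assms(2) by auto
  moreover have "{..L - 1} = {..<L}"
    using assms(2) by auto
  ultimately have sum0: "(\<Sum>k<L. \<zeta> ^ k) = 0"
    by simp
  have "\<zeta> ^ L - 1 = 0"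
    unfolding power_diff_1_eq sum0 by simp
  moreover have "of_nat L = (1::'a)"
    using assms(1) of_nat_CHAR[where 'a = 'a] by (auto elim!: oddE simp: char2)
  then have "\<zeta> \<noteq> 1"
    using sum0 by auto
  ultimately show thesis
    using that by simp
qed

lemma root_of_unity_power:
  assumes "prime L" "\<zeta> ^ L = 1" "\<zeta> \<noteq> 1" "\<zeta> ^ j = (1::'a)"
  shows "L dvd j"
proof (rule ccontr)
  assume "\<not> L dvd j"
  then have "coprime L j"
    by (rule prime_imp_coprime[OF assms(1)])
  then obtain x y where "L * x = j * y + 1"
    using bezout_nat[of L j] prime_gt_0_nat[OF assms(1)] by auto
  then have "\<zeta> ^ (L * x) = \<zeta> ^ (j * y) * \<zeta>"
    by simp
  then show False
    using assms by (simp add: power_mult)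
qed

text \<open>
  A metaplectic operator over an element of order \<open>L\<close> of \<open>SL\<^sub>2\<close>, whose eigenvalues
  are \<open>\<zeta>\<close> and \<open>\<zeta>\<^sup>-\<^sup>1\<close>. Its \<open>L\<close>-th power is only a Weyl operator up to
  phase, so the square has to be taken.
\<close>

lemma cyclic_unitary_metaplectic:
  assumes L: "prime L" "L = 2 * n + 1"
  shows "\<exists>U. unitary_mat (2 ^ n) U \<and> U ^\<^sub>m L = 1\<^sub>m (2 ^ n) \<and>
    (\<forall>k i j. 0 < k \<longrightarrow> k < L \<longrightarrow> i < 2 ^ n \<longrightarrow> j < 2 ^ n \<longrightarrow>
      cmod ((U ^\<^sub>m k) $$ (i, j)) = 1 / sqrt (real (2 ^ n)))"
proof -
  have odd: "odd L" "L > 2"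
    using L n_pos by auto
  obtain \<zeta> :: 'a where \<zeta>: "\<zeta> ^ L = 1" "\<zeta> \<noteq> 1"
    using root_of_unity_exists[of L] odd by auto
  define \<kappa> where "\<kappa> = inverse \<zeta>"
  have \<zeta>0: "\<zeta> \<noteq> 0"
    using \<zeta>(1) odd by (auto simp: power_0_left)
  have \<zeta>\<kappa>: "\<zeta> * \<kappa> = 1"
    by (simp add: \<kappa>_def \<zeta>0)
  have \<kappa>L: "\<kappa> ^ L = 1"
    by (simp add: \<kappa>_def power_inverse \<zeta>(1))
  \<comment> \<open>The trace of the \<open>k\<close>-th power of a matrix with eigenvalues
    \<open>\<zeta>\<close> and \<open>\<kappa>\<close>. As signs vanish, it is also the difference
    of the two powers, so that \<open>w k / s\<close> is the usual Lucas quotient.\<close>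
  define w where "w k = \<zeta> ^ k + \<kappa> ^ k" for k
  have w0: "L dvd 2 * k" if "w k = 0" for k
  proof (rule root_of_unity_power[OF L(1) \<zeta>])
    have "\<zeta> ^ k = \<kappa> ^ k"
      using that by (simp add: w_def add_eq_0_iff_eq)
    then have "\<zeta> ^ (2 * k) = (\<zeta> * \<kappa>) ^ k"
      by (simp add: mult_2 power_add power_mult_distrib)
    then show "\<zeta> ^ (2 * k) = 1"
      by (simp add: \<zeta>\<kappa>)
  qed
  define s where "s = w 1"
  have s0: "s \<noteq> 0"
    using w0[of 1] odd nat_dvd_not_less[of 2 L] unfolding s_def by auto
  \<comment> \<open>By Fermat \<open>L\<close> divides \<open>(2 ^ n - 1) * (2 ^ n + 1)\<close>. In
    the first case the power \<open>2 ^ n\<close> fixes \<open>\<zeta>\<close> and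
    \<open>\<kappa>\<close>, in the second it exchanges them; their sum is fixed either way, even if
    \<open>\<zeta>\<close> is not in \<open>F\<close>.\<close>
  have s_F: "s \<in> F"
  proof -
    have "\<not> L dvd 2"
      using odd nat_dvd_not_less[of 2 L] by simp
    then have "[2 ^ (L - 1) = 1] (mod L)"
      by (rule fermat_theorem[OF L(1)])
    then have "L dvd 2 ^ (2 * n) - 1"
      using cong_to_1_nat[of "2 ^ (L - 1)" L] L(2) by simp
    also have "(2::nat) ^ (2 * n) - 1 = (2 ^ n - 1) * (2 ^ n + 1)"
      unfolding mult_2 power_add by (simp add: algebra_simps)
    finally have "L dvd 2 ^ n - 1 \<or> L dvd 2 ^ n + 1"
      by (rule prime_dvd_multD[OF L(1)])
    then show ?thesis
    proof
      assume "L dvd 2 ^ n - 1"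
      then obtain j where "(2::nat) ^ n - 1 = L * j"
        by (auto elim: dvdE)
      then have "(2::nat) ^ n = L * j + 1"
        by (metis Suc_eq_plus1 Suc_pred' zero_less_numeral zero_less_power)
      then have "x ^ 2 ^ n = x" if "x ^ L = 1" for x :: 'a
        using that by (simp add: power_mult)
      then show ?thesis
        using \<zeta>(1) \<kappa>L by (simp add: F_eq s_def w_def frobenius_add)
    next
      assume "L dvd 2 ^ n + 1"
      then obtain j where j: "(2::nat) ^ n + 1 = L * j"
        by (auto elim: dvdE)
      have "x ^ 2 ^ n * x = 1" if "x ^ L = 1" for x :: 'a
      proof -
        have "x ^ 2 ^ n * x = x ^ (2 ^ n + 1)"
          by simp
        then show ?thesis
          unfolding j using that by (simp add: power_mult)
      qed
      then have "\<zeta> ^ 2 ^ n * \<zeta> = \<kappa> * \<zeta>" "\<kappa> ^ 2 ^ n * \<kappa> = \<zeta> * \<kappa>"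
        using \<zeta>(1) \<kappa>L \<zeta>\<kappa> by (simp_all add: mult.commute)
      then have "\<zeta> ^ 2 ^ n = \<kappa>" "\<kappa> ^ 2 ^ n = \<zeta>"
        using \<zeta>0 by (simp_all only: mult_right_cancel nonzero_imp_inverse_nonzero \<kappa>_def not_False_eq_True)
      then show ?thesis
        by (simp add: F_eq s_def w_def frobenius_add add.commute)
    qed
  qed
  obtain t where t: "t \<in> F" "t\<^sup>2 = s"
    using F_square_root[OF s_F] .
  define U where "U = fourier * diag_op (\<lambda>x. quarter (t * x))"
  \<comment> \<open>As a matrix this has rows \<open>(s, 1)\<close> and \<open>(1, 0)\<close>: trace
    \<open>s\<close> and, in characteristic 2, determinant 1. Hence its eigenvalues are
    \<open>\<zeta>\<close> and \<open>\<kappa>\<close>.\<close>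
  define \<sigma> where "\<sigma> = (\<lambda>(a, b). (b, a)) \<circ> (\<lambda>(a, b). (a, b + s * a :: 'a))"
  have U: "unitary_mat (2 ^ n) U"
    unfolding U_def by (intro unitary_mat_mult unitary_fourier unitary_diag_op) simp
  have norm: "normalizes U \<sigma>"
    unfolding U_def \<sigma>_def using normalizes_diag_quarter(1)[OF t(1)] t(2)
    by (intro normalizes_mult normalizes_fourier) simp
  have \<sigma>: "\<sigma> v = (snd v + s * fst v, fst v)" for v
    by (simp add: \<sigma>_def split_beta)
  \<comment> \<open>This is \<open>w\<close> at index \<open>k - 1\<close>, taken with integer
    exponents: at \<open>k = 0\<close> the value must be \<open>s\<close>, whereas truncated
    subtraction would give \<open>w 0 = 0\<close>.\<close>
  define w' where "w' k = \<zeta> ^ k * \<kappa> + \<kappa> ^ k * \<zeta>" for k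
  have rec: "w' k + s * w k = w (Suc k)" "w' (Suc k) = w k" for k
  proof -
    show "w' (Suc k) = w k"
    proof -
      have "w' (Suc k) = (\<zeta> * \<kappa>) * w k"
        by (simp add: w_def w'_def algebra_simps)
      then show ?thesis
        by (simp add: \<zeta>\<kappa>)
    qed
    have "s * w k = w (Suc k) + w' k"
      by (simp add: s_def w_def w'_def algebra_simps)
    then show "w' k + s * w k = w (Suc k)"
      by (metis add.commute add_self_left)
  qed
  \<comment> \<open>Closed form for the powers of the matrix of \<open>\<sigma>\<close>, whose
    entries are Lucas quotients; multiplying by \<open>s\<close> clears the denominators.\<close>
  have \<sigma>_pow: "s * fst ((\<sigma> ^^ k) (a, b)) = w (Suc k) * a + w k * b \<and>
      s * snd ((\<sigma> ^^ k) (a, b)) = w k * a + w' k * b" for k a b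
  proof (induction k)
    case 0
    then show ?case
      by (simp add: s_def w_def w'_def add.commute)
  next
    case (Suc k)
    define u where "u = (\<sigma> ^^ k) (a, b)"
    have step: "(\<sigma> ^^ Suc k) (a, b) = (snd u + s * fst u, fst u)"
      by (simp add: \<sigma> u_def)
    have IH: "s * fst u = w (Suc k) * a + w k * b" "s * snd u = w k * a + w' k * b"
      using Suc by (simp_all only: u_def)
    have "s * (snd u + s * fst u) = (w' (Suc k) + s * w (Suc k)) * a + (w' k + s * w k) * b"
      unfolding distrib_left IH rec(2) by (simp add: algebra_simps)
    then have "s * fst ((\<sigma> ^^ Suc k) (a, b)) = w (Suc (Suc k)) * a + w (Suc k) * b"
      unfolding rec(1) step by simp
    moreover have "s * snd ((\<sigma> ^^ Suc k) (a, b)) = w (Suc k) * a + w' (Suc k) * b"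
      unfolding rec(2) step by (simp add: IH)
    ultimately show ?case ..
  qed
  have "normalizes (U ^\<^sub>m L) (\<sigma> ^^ L)"
    by (rule normalizes_pow[OF norm])
  moreover have "(\<sigma> ^^ L) v = v" for v
  proof -
    have "w L = 0" "w (Suc L) = s" "w' L = s"
      by (simp_all add: w_def w'_def s_def \<zeta>(1) \<kappa>L add.commute)
    then have "s * fst ((\<sigma> ^^ L) v) = s * fst v" "s * snd ((\<sigma> ^^ L) v) = s * snd v"
      using \<sigma>_pow[of L "fst v" "snd v"] by simp_all
    then show ?thesis
      using s0 by (simp add: prod_eq_iff)
  qed
  ultimately obtain \<theta> where \<theta>: "cmod \<theta> = 1" "U ^\<^sub>m L * U ^\<^sub>m L = \<theta> \<cdot>\<^sub>m 1\<^sub>m (2 ^ n)"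
    using square_scalar[OF unitary_mat_pow[OF U]] by metis
  obtain r where r: "r ^ L = inverse \<theta>"
    using nth_root_exists[of L "inverse \<theta>"] odd by auto
  then have "cmod r ^ L = 1"
    using \<theta>(1) by (metis norm_inverse inverse_1 norm_power)
  then have r1: "cmod r = 1"
    using odd power_eq_imp_eq_base[of "cmod r" L 1] by simp
  \<comment> \<open>The scalar \<open>r\<close> absorbs \<open>\<theta>\<close>, so that the
    \<open>L\<close>-th power becomes the identity. Squaring keeps the smaller powers nontrivial:
    \<open>L\<close> is odd, so it divides \<open>2 * k\<close> only if it divides
    \<open>k\<close>.\<close>
  define V where "V = r \<cdot>\<^sub>m (U ^\<^sub>m 2)"
  note UC = unitary_mat_carrier[OF U]
  have U2C: "U ^\<^sub>m 2 \<in> carrier_mat (2 ^ n) (2 ^ n)"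
    using unitary_mat_carrier[OF unitary_mat_pow[OF U]] .
  have V: "unitary_mat (2 ^ n) V"
    unfolding V_def by (rule unitary_mat_smult[OF unitary_mat_pow[OF U] r1])
  have V_pow: "V ^\<^sub>m k = r ^ k \<cdot>\<^sub>m U ^\<^sub>m (2 * k)" for k
    unfolding V_def smult_pow_mat[OF U2C] pow_mat_mult[OF UC] ..
  have "V ^\<^sub>m L = r ^ L \<cdot>\<^sub>m (U ^\<^sub>m L * U ^\<^sub>m L)"
    unfolding V_pow mult_2 pow_mat_add[OF UC] ..
  also have "\<dots> = (inverse \<theta> * \<theta>) \<cdot>\<^sub>m 1\<^sub>m (2 ^ n)"
    by (simp add: \<theta>(2) r smult_smult_mat)
  also have "inverse \<theta> * \<theta> = 1"
    using \<theta>(1) by (intro left_inverse) auto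
  finally have VL: "V ^\<^sub>m L = 1\<^sub>m (2 ^ n)"
    by simp
  have flat: "cmod ((V ^\<^sub>m k) $$ (i, j)) = 1 / sqrt (real (2 ^ n))"
    if k: "0 < k" "k < L" and ij: "i < 2 ^ n" "j < 2 ^ n" for k i j
  proof (rule flat_entries[OF unitary_mat_pow[OF V] _ _ ij])
    show norm_k: "normalizes (V ^\<^sub>m k) (\<sigma> ^^ (2 * k))"
      unfolding V_pow by (intro normalizes_smult normalizes_pow norm)
    have wk: "w (2 * k) \<noteq> 0"
    proof
      assume "w (2 * k) = 0"
      then have "L dvd 4 * k"
        using w0[of "2 * k"] by simp
      moreover have "coprime L 4"
        using odd(1) coprime_power_right_iff[of L 2 2] by simp
      ultimately have "L dvd k"
        by (simp add: coprime_dvd_mult_right_iff)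
      then show False
        using k by (auto dest: dvd_imp_le)
    qed
    have fst_eq: "fst ((\<sigma> ^^ (2 * k)) (0, b)) = w (2 * k) / s * b" for b
      using \<sigma>_pow[of "2 * k" 0 b] s0 by (simp add: field_simps)
    \<comment> \<open>The numbers \<open>w (2 * k)\<close> are defined through
      \<open>\<zeta>\<close>, which may lie outside \<open>F\<close>. The quotient is in
      \<open>F\<close> because it is a coordinate of the image of a label over
      \<open>F\<close>.\<close>
    have "(\<sigma> ^^ (2 * k)) (0, 1) \<in> F \<times> F"
      by (rule normalizesD(2)[OF norm_k]) simp
    then have "fst ((\<sigma> ^^ (2 * k)) (0, 1)) \<in> F"
      by (rule SigmaE) simp
    then have wF: "w (2 * k) / s \<in> F"
      by (simp add: fst_eq)
    show "F \<subseteq> (\<lambda>b. fst ((\<sigma> ^^ (2 * k)) (0, b))) ` F"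
    proof
      fix y assume "y \<in> F"
      then have "y / (w (2 * k) / s) \<in> F"
        using wF by (rule F_divide)
      then show "y \<in> (\<lambda>b. fst ((\<sigma> ^^ (2 * k)) (0, b))) ` F"
        unfolding fst_eq using wk s0 by (intro image_eqI[of _ _ "y / (w (2 * k) / s)"]) simp_all
    qed
  qed
  show ?thesis
    using V VL flat by blast
qed

end

theorem mainTheorem1:
  fixes n L :: nat
  assumes "n \<ge> 1"
    and "2 \<le> L" and "L \<le> 2 * n + 1"
    and "prime L"
    and "L dvd n \<or> L = 2 * n + 1"
  shows "\<exists>B :: nat \<Rightarrow> complex vec set.
           inj_on B {0..<L} \<and> mub_set (2 ^ n) (B ` {0..<L}) \<and>
           (\<exists>U. unitary_mat (2 ^ n) U \<and>
                (\<forall>j\<in>{0..<L}. (\<lambda>v. U *\<^sub>v v) ` B j = B ((j + 1) mod L)))"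
proof -
  \<comment> \<open>The ambient field is the algebraic closure of the two-element field
    \<open>bit\<close>, where a natural number is just its parity.\<close>
  have "of_nat k = (of_bool (odd k) :: bit)" for k
    by (induction k) auto
  then have "CHAR(bit) = 2"
    by (intro CHAR_eqI) auto
  then interpret char2_finite_field n "{x :: bit alg_closure. x ^ 2 ^ n = x}"
    using assms(1) by unfold_locales auto
  obtain U where U: "unitary_mat (2 ^ n) U" "U ^\<^sub>m L = 1\<^sub>m (2 ^ n)"
    "\<And>k i j. \<lbrakk>0 < k; k < L; i < 2 ^ n; j < 2 ^ n\<rbrakk> \<Longrightarrow>
      cmod ((U ^\<^sub>m k) $$ (i, j)) = 1 / sqrt (real (2 ^ n))"
    using assms(5)
  proof
    assume "L dvd n"
    then obtain m where "n = m * L"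
      by (metis dvd_def mult.commute)
    then show thesis
      using cyclic_unitary_frobenius[OF assms(4), of m] that by blast
  next
    assume "L = 2 * n + 1"
    then show thesis
      using cyclic_unitary_metaplectic[OF assms(4)] that by blast
  qed
  show ?thesis
  proof (rule cyclic_mubs_of_unitary[OF U(1) _ U(2) _ U(3)])
    show "1 < (2::nat) ^ n"
      using assms(1) by (intro one_less_power) auto
  qed (use assms(2) in auto)
qed

end
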